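(* Suppose $r=0$ and $\gamma_n>0$. For $q\in[0,1)$ and $\kappa\in\mathbb R$, let $\big((\mu_1^{(q,\kappa)},\mu_2^{(q,\kappa)},\gamma_n),c^{(q,\kappa)}\big)$ denote the unique steady-state beliefs and cutoff in the stage game with parameters $(q,\kappa)$. Then the steady-state belief $\mu_2^{(q,\kappa)}$ is strictly increasing in $q$ and strictly decreasing in $\kappa$, but always satisfies $\mu_2^{(q,\kappa)}<\mu_2^\bullet$. The steady-state cutoff threshold $c^{(q,\kappa)}$ is strictly increasing in $q$ and strictly decreasing in $\kappa$.
   Context: Fix $\sigma>0$, true means $\mu_1^\bullet,\mu_2^\bullet\in\mathbb R$, a true reversal parameter $r\in\mathbb R$ and an interval $[\gamma_l,\gamma_h]$, with $r,\gamma_l,\gamma_h\ne-1$. Let $\gamma_n:=\arg\min_{\gamma\in[\gamma_l,\gamma_h]}|\gamma-r|$. Stage game with parameters $(q,\kappa)$: the agent observes $X_1=x_1$ and either stops, receiving $u_1(x_1)=x_1$, or continues, in which case $X_2=x_2$ is drawn and she receives $u_2(x_1,x_2)=q\max(x_1,x_2)+(1-q)x_2-\kappa$. A strategy is a measurable map $S:\mathbb R\to\{\text{Stop},\text{Continue}\}$; strategies that differ only on a Lebesgue-null set are identified. $S$ continues with positive probability if $S^{-1}(\text{Continue})$ has positive Lebesgue measure. $\Psi(\mu_1,\mu_2;\gamma)$ is the joint law with $X_1\sim\mathcal N(\mu_1,\sigma^2)$, $X_2\mid(X_1=x_1)\sim\mathcal N(\mu_2-\gamma(x_1-\mu_1),\sigma^2)$;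 the true law is $\Psi(\mu_1^\bullet,\mu_2^\bullet;r)$. The history is $(x_1,\varnothing)$ if $S(x_1)=\text{Stop}$ and $(x_1,x_2)$ if $S(x_1)=\text{Continue}$; $\mathcal H(\Psi;S)$ is the law of the history when $(X_1,X_2)\sim\Psi$, and $\mathcal H^\bullet(S):=\mathcal H(\Psi(\mu_1^\bullet,\mu_2^\bullet;r);S)$. For $S$ continuing with positive probability, the pseudo-true parameters $(\mu_1^*(S),\mu_2^*(S),\gamma^*(S))$ are the minimizer of the Kullback–Leibler divergence $D_{KL}(\mathcal H^\bullet(S)\,\|\,\mathcal H(\Psi(\mu_1,\mu_2;\gamma);S))$ over $\mathbb R^2\times[\gamma_l,\gamma_h]$. A steady state consists of $\mu_1^\infty,\mu_2^\infty\in\mathbb R$, $\gamma^\infty\in[\gamma_l,\gamma_h]$ and a strategy $S^\infty$ such that (i) $S^\infty$ continues with positive probability and maximizes expected payoff among all strategies when $(X_1,X_2)\sim\Psi(\mu_1^\infty,\mu_2^\infty;\gamma^\infty)$; (ii) $(\mu_1^\infty,\mu_2^\infty,\gamma^\infty)=(\mu_1^*(S^\infty),\mu_2^*(S^\infty),\gamma^*(S^\infty))$. When $r=0$ and $\gamma_n>0$, for every $(q,\kappa)$ there is a unique steady state; it has $\gamma^\infty=\gamma_n$, and its strategy stops iff $x_1\ge c$ for a real number $c$, called the steady-state cutoff. *)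

theory Defs
  imports "HOL-Probability.Probability"
begin

datatype action = Stop | Continue

definition strategies :: "(real \<Rightarrow> action) set" where
  "strategies = borel \<rightarrow>\<^sub>M count_space UNIV"

definition continues_with_pos_prob :: "(real \<Rightarrow> action) \<Rightarrow> bool" where
  "continues_with_pos_prob S \<longleftrightarrow> emeasure lborel (S -` {Continue}) > 0"

definition u1 :: "real \<Rightarrow> real" where
  "u1 x1 = x1"

definition u2 :: "real \<Rightarrow> real \<Rightarrow> real \<Rightarrow> real \<Rightarrow> real" where
  "u2 q \<kappa> x1 x2 = q * max x1 x2 + (1 - q) * x2 - \<kappa>"

definition payoff :: "real \<Rightarrow> real \<Rightarrow> (real \<Rightarrow> action) \<Rightarrow> real \<times> real \<Rightarrow> real" where
  "payoff q \<kappa> S = (\<lambda>(x1, x2). case S x1 of Stop \<Rightarrow> u1 x1 | Continue \<Rightarrow> u2 q \<kappa> x1 x2)"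

(* The joint law is given by its density: the marginal density of X1 times the conditional
   density of X2 given X1 = x1.  The second argument of normal_density is the standard
   deviation, not the variance. *)
definition Psi :: "real \<Rightarrow> real \<Rightarrow> real \<Rightarrow> real \<Rightarrow> (real \<times> real) measure" where
  "Psi \<sigma> \<mu>1 \<mu>2 \<gamma> = density (lborel \<Otimes>\<^sub>M lborel)
     (\<lambda>(x1, x2). ennreal (normal_density \<mu>1 \<sigma> x1 * normal_density (\<mu>2 - \<gamma> * (x1 - \<mu>1)) \<sigma> x2))"

(* A history is (x1, None) after stopping and (x1, Some x2) after continuing.  The library has
   no sigma-algebra on option types; this is the disjoint-union one, with None an atom. *)
definition option_space :: "'a measure \<Rightarrow> 'a option measure" where
  "option_space M = sigma (insert None (Some ` space M)) (insert {None} ((`) Some ` sets M))"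

definition history_space :: "(real \<times> real option) measure" where
  "history_space = borel \<Otimes>\<^sub>M option_space borel"

definition history :: "(real \<Rightarrow> action) \<Rightarrow> real \<times> real \<Rightarrow> real \<times> real option" where
  "history S = (\<lambda>(x1, x2). (x1, case S x1 of Stop \<Rightarrow> None | Continue \<Rightarrow> Some x2))"

definition history_law :: "(real \<times> real) measure \<Rightarrow> (real \<Rightarrow> action) \<Rightarrow> (real \<times> real option) measure" where
  "history_law P S = distr P history_space (history S)"

(* The history map is measurable, so that history_law is the genuine push-forward. *)
lemma measurable_history:
  assumes "S \<in> strategies"
  shows "history S \<in> borel \<Otimes>\<^sub>M borel \<rightarrow>\<^sub>M history_space"
proof -
  have S [measurable]: "S \<in> borel \<rightarrow>\<^sub>M count_space UNIV"
    using assms by (simp add: strategies_def)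
  have "(\<lambda>(x1, x2). case S x1 of Stop \<Rightarrow> None | Continue \<Rightarrow> Some x2)
          \<in> borel \<Otimes>\<^sub>M borel \<rightarrow>\<^sub>M option_space (borel :: real measure)" (is "?h \<in> _")
    unfolding option_space_def
  proof (rule measurable_measure_of)
    fix y assume "y \<in> insert {None} ((`) Some ` sets (borel :: real measure))"
    then consider "y = {None}" | A where "A \<in> sets (borel :: real measure)" "y = Some ` A"
      by auto
    then show "?h -` y \<inter> space (borel \<Otimes>\<^sub>M borel) \<in> sets (borel \<Otimes>\<^sub>M borel)"
    proof cases
      case 1
      have "?h -` y \<inter> space (borel \<Otimes>\<^sub>M borel)
              = {z \<in> space (borel \<Otimes>\<^sub>M borel). S (fst z) = Stop}"
        using 1 by (auto split: action.splits)
      also have "\<dots> \<in> sets (borel \<Otimes>\<^sub>M borel)" by measurable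
      finally show ?thesis .
    next
      case 2
      note [measurable] = 2(1)
      have "?h -` y \<inter> space (borel \<Otimes>\<^sub>M borel)
              = {z \<in> space (borel \<Otimes>\<^sub>M borel). S (fst z) = Continue \<and> snd z \<in> A}"
        using 2 by (auto split: action.splits)
      also have "\<dots> \<in> sets (borel \<Otimes>\<^sub>M borel)" by measurable
      finally show ?thesis .
    qed
  qed (auto split: action.splits)
  then show ?thesis
    unfolding history_space_def history_def
    by (intro measurable_pair) (auto simp: comp_def case_prod_unfold)
qed

(* The library's KL_divergence b M N is the divergence of N from M (the integral is taken
   with respect to N), so the true history law is the last argument; base exp 1 gives the
   natural logarithm. *)
definition history_KL ::
  "real \<Rightarrow> real \<Rightarrow> real \<Rightarrow> real \<Rightarrow> (real \<Rightarrow> action) \<Rightarrow> real \<times> real \<times> real \<Rightarrow> real" where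
  "history_KL \<sigma> m1 m2 r S = (\<lambda>(\<mu>1, \<mu>2, \<gamma>).
     KL_divergence (exp 1) (history_law (Psi \<sigma> \<mu>1 \<mu>2 \<gamma>) S) (history_law (Psi \<sigma> m1 m2 r) S))"

definition pseudo_true ::
  "real \<Rightarrow> real \<Rightarrow> real \<Rightarrow> real \<Rightarrow> real \<Rightarrow> real \<Rightarrow> (real \<Rightarrow> action) \<Rightarrow> real \<times> real \<times> real" where
  "pseudo_true \<sigma> m1 m2 r \<gamma>l \<gamma>h S =
     arg_min_on (history_KL \<sigma> m1 m2 r S) (UNIV \<times> UNIV \<times> {\<gamma>l..\<gamma>h})"

definition optimal_strategy ::
  "real \<Rightarrow> real \<Rightarrow> (real \<times> real) measure \<Rightarrow> (real \<Rightarrow> action) \<Rightarrow> bool" where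
  "optimal_strategy q \<kappa> P S \<longleftrightarrow> S \<in> strategies \<and>
     (\<forall>S' \<in> strategies. (\<integral>x. payoff q \<kappa> S' x \<partial>P) \<le> (\<integral>x. payoff q \<kappa> S x \<partial>P))"

definition steady_state ::
  "real \<Rightarrow> real \<Rightarrow> real \<Rightarrow> real \<Rightarrow> real \<Rightarrow> real \<Rightarrow> real \<Rightarrow> real \<Rightarrow>
   real \<Rightarrow> real \<Rightarrow> real \<Rightarrow> (real \<Rightarrow> action) \<Rightarrow> bool" where
  "steady_state \<sigma> m1 m2 r \<gamma>l \<gamma>h q \<kappa> \<mu>1 \<mu>2 \<gamma> S \<longleftrightarrow>
     \<gamma> \<in> {\<gamma>l..\<gamma>h} \<and>
     continues_with_pos_prob S \<and>
     optimal_strategy q \<kappa> (Psi \<sigma> \<mu>1 \<mu>2 \<gamma>) S \<and>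
     (\<mu>1, \<mu>2, \<gamma>) = pseudo_true \<sigma> m1 m2 r \<gamma>l \<gamma>h S"

(* Strategies are identified when they agree Lebesgue-almost everywhere. *)
definition has_cutoff :: "(real \<Rightarrow> action) \<Rightarrow> real \<Rightarrow> bool" where
  "has_cutoff S c \<longleftrightarrow> (AE x1 in lborel. S x1 = Stop \<longleftrightarrow> c \<le> x1)"

definition the_steady_state ::
  "real \<Rightarrow> real \<Rightarrow> real \<Rightarrow> real \<Rightarrow> real \<Rightarrow> real \<Rightarrow> real \<Rightarrow> real \<Rightarrow>
   (real \<times> real \<times> real) \<times> real" where
  "the_steady_state \<sigma> m1 m2 r \<gamma>l \<gamma>h q \<kappa> =
     (THE ((\<mu>1, \<mu>2, \<gamma>), c). \<exists>S. steady_state \<sigma> m1 m2 r \<gamma>l \<gamma>h q \<kappa> \<mu>1 \<mu>2 \<gamma> S \<and> has_cutoff S c)"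

definition steady_belief2 ::
  "real \<Rightarrow> real \<Rightarrow> real \<Rightarrow> real \<Rightarrow> real \<Rightarrow> real \<Rightarrow> real \<Rightarrow> real \<Rightarrow> real" where
  "steady_belief2 \<sigma> m1 m2 r \<gamma>l \<gamma>h q \<kappa> =
     (case the_steady_state \<sigma> m1 m2 r \<gamma>l \<gamma>h q \<kappa> of ((\<mu>1, \<mu>2, \<gamma>), c) \<Rightarrow> \<mu>2)"

definition steady_cutoff ::
  "real \<Rightarrow> real \<Rightarrow> real \<Rightarrow> real \<Rightarrow> real \<Rightarrow> real \<Rightarrow> real \<Rightarrow> real \<Rightarrow> real" where
  "steady_cutoff \<sigma> m1 m2 r \<gamma>l \<gamma>h q \<kappa> = snd (the_steady_state \<sigma> m1 m2 r \<gamma>l \<gamma>h q \<kappa>)"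

definition gamma_near :: "real \<Rightarrow> real \<Rightarrow> real \<Rightarrow> real" where
  "gamma_near r \<gamma>l \<gamma>h = arg_min_on (\<lambda>\<gamma>. \<bar>\<gamma> - r\<bar>) {\<gamma>l..\<gamma>h}"

end

theory Submission
  imports Defs
begin

text \<open>
  The divergence of the histories equals, up to the factor \<open>1 / (2 \<sigma>\<^sup>2)\<close>, the quadratic form
  \<open>(m1 - \<mu>1)\<^sup>2 + E[1\<^sub>C(X\<^sub>1) (m2 - \<mu>2 + \<gamma> (X\<^sub>1 - \<mu>1))\<^sup>2]\<close>, where \<open>C\<close> is the continuation region.
  For \<open>\<gamma> \<ge> \<gamma>l > 0\<close> its unique minimizer is \<open>(m1, m2 - \<gamma>l (m1 - E[X\<^sub>1 | C]), \<gamma>l)\<close>. On the other side,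
  continuing at \<open>x\<close> gains \<open>G\<^sub>q(t) - \<kappa>\<close> with \<open>t = \<mu>2 + \<gamma> \<mu>1 - (1 + \<gamma>) x\<close> and \<open>G\<^sub>q\<close> a strictly increasing
  bijection of the line, so optimal strategies are exactly the cutoff strategies at the zero of the gain.
  A steady state is therefore a solution \<open>c\<close> of \<open>G\<^sub>q(m2 + \<gamma>l e(c) - (1 + \<gamma>l) c) = \<kappa>\<close> with
  \<open>e(c) = E[X\<^sub>1 | X\<^sub>1 < c]\<close>. Since \<open>e\<close> and \<open>c - e(c)\<close> are both monotone, the argument of \<open>G\<^sub>q\<close> is continuous,
  strictly decreasing and onto; as \<open>G\<^sub>q\<close> also increases strictly with \<open>q\<close>, the solution moves as
  claimed, and the belief \<open>m2 - \<gamma>l (m1 - e(c))\<close> moves with it.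
\<close>

section \<open>Gaussian integrals\<close>

definition gauss :: "real \<Rightarrow> real \<Rightarrow> real measure" where
  "gauss \<sigma> \<mu> = density lborel (normal_density \<mu> \<sigma>)"

lemma sets_gauss [measurable_cong, simp]: "sets (gauss \<sigma> \<mu>) = sets borel"
  by (simp add: gauss_def)

lemma space_gauss [simp]: "space (gauss \<sigma> \<mu>) = UNIV"
  by (simp add: gauss_def)

lemma prob_space_gauss: "0 < \<sigma> \<Longrightarrow> prob_space (gauss \<sigma> \<mu>)"
  unfolding gauss_def by (rule prob_space_normal_density)

text \<open>The normal density is positive everywhere, so both measures have the same null sets.
  This links the almost-everywhere identification of strategies to expected values.\<close>

lemma AE_gauss_iff:
  assumes "0 < \<sigma>"
  shows "(AE x in gauss \<sigma> \<mu>. P x) \<longleftrightarrow> (AE x in lborel. P x)"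
  unfolding gauss_def using normal_density_pos[OF assms, of \<mu>] by (subst AE_density) auto

lemma integral_gauss:
  fixes f :: "real \<Rightarrow> real"
  assumes "f \<in> borel_measurable borel"
  shows "(\<integral>x. f x \<partial>gauss \<sigma> \<mu>) = (\<integral>x. normal_density \<mu> \<sigma> x * f x \<partial>lborel)"
  using assms by (simp add: gauss_def integral_density)

lemma integrable_gauss_iff:
  fixes f :: "real \<Rightarrow> real"
  assumes "f \<in> borel_measurable borel"
  shows "integrable (gauss \<sigma> \<mu>) f \<longleftrightarrow> integrable lborel (\<lambda>x. normal_density \<mu> \<sigma> x * f x)"
  using assms by (simp add: gauss_def integrable_density)

lemma measure_gauss_UNIV [simp]: "0 < \<sigma> \<Longrightarrow> measure (gauss \<sigma> \<mu>) UNIV = 1"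
  using prob_space.prob_space[OF prob_space_gauss] by simp

lemma integrable_gauss_const [simp]:
  "0 < \<sigma> \<Longrightarrow> integrable (gauss \<sigma> \<mu>) (\<lambda>x. c :: real)"
  by (simp add: prob_space.finite_measure finite_measure.integrable_const prob_space_gauss)

lemma integral_gauss_const [simp]:
  "0 < \<sigma> \<Longrightarrow> (\<integral>x. (c :: real) \<partial>gauss \<sigma> \<mu>) = c"
  by simp

lemma integrable_gauss_id [simp]: "0 < \<sigma> \<Longrightarrow> integrable (gauss \<sigma> \<mu>) (\<lambda>x. x)"
  by (simp add: integrable_gauss_iff integrable_normal_moment_nz_1)

lemma integral_gauss_id [simp]: "0 < \<sigma> \<Longrightarrow> (\<integral>x. x \<partial>gauss \<sigma> \<mu>) = \<mu>"
  by (simp add: integral_gauss integral_normal_moment_nz_1)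

lemma gauss_power2:
  assumes "0 < \<sigma>"
  shows integrable_gauss_power2: "integrable (gauss \<sigma> \<mu>) (\<lambda>x. x\<^sup>2)"
    and integral_gauss_power2: "(\<integral>x. x\<^sup>2 \<partial>gauss \<sigma> \<mu>) = \<mu>\<^sup>2 + \<sigma>\<^sup>2"
proof -
  have i: "integrable (gauss \<sigma> \<mu>) (\<lambda>x. (x - \<mu>)\<^sup>2)"
    using integrable_normal_moment[OF assms, of \<mu> 2] by (simp add: integrable_gauss_iff)
  have v: "(\<integral>x. (x - \<mu>)\<^sup>2 \<partial>gauss \<sigma> \<mu>) = \<sigma>\<^sup>2"
    using integral_normal_moment_even[OF assms, of \<mu> 1] by (simp add: integral_gauss fact_numeral)
  have eq: "(\<lambda>x. x\<^sup>2) = (\<lambda>x. (x - \<mu>)\<^sup>2 + (2 * \<mu> * x - \<mu>\<^sup>2))"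
    by (auto simp: power2_eq_square algebra_simps)
  show "integrable (gauss \<sigma> \<mu>) (\<lambda>x. x\<^sup>2)"
    unfolding eq using i assms by (intro Bochner_Integration.integrable_add Bochner_Integration.integrable_diff) auto
  have "(\<integral>x. (x - \<mu>)\<^sup>2 + (2 * \<mu> * x - \<mu>\<^sup>2) \<partial>gauss \<sigma> \<mu>) = \<sigma>\<^sup>2 + (2 * \<mu> * \<mu> - \<mu>\<^sup>2)"
    using i v assms by simp
  then show "(\<integral>x. x\<^sup>2 \<partial>gauss \<sigma> \<mu>) = \<mu>\<^sup>2 + \<sigma>\<^sup>2"
    unfolding eq by (simp add: power2_eq_square)
qed

lemma integrable_gauss_bound:
  fixes f :: "real \<Rightarrow> real"
  assumes "0 < \<sigma>" "f \<in> borel_measurable borel" "\<And>x. \<bar>f x\<bar> \<le> a + b * x\<^sup>2"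
  shows "integrable (gauss \<sigma> \<mu>) f"
proof (rule Bochner_Integration.integrable_bound)
  show "integrable (gauss \<sigma> \<mu>) (\<lambda>x. a + b * x\<^sup>2)"
    using assms(1) by (intro Bochner_Integration.integrable_add) (auto simp: integrable_gauss_power2)
  show "f \<in> borel_measurable (gauss \<sigma> \<mu>)"
    using assms(2) by simp
  show "AE x in gauss \<sigma> \<mu>. norm (f x) \<le> norm (a + b * x\<^sup>2)"
    by (intro AE_I2) (metis assms(3) real_norm_def abs_ge_self order_trans)
qed

lemma abs_le_one_plus_power2: "\<bar>x\<bar> \<le> 1 + x\<^sup>2" for x :: real
proof -
  have "0 \<le> (\<bar>x\<bar> - 1)\<^sup>2" by simp
  then have "2 * \<bar>x\<bar> \<le> 1 + x\<^sup>2"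
    by (simp add: power2_eq_square algebra_simps)
  then show ?thesis by linarith
qed

lemma integrable_gauss_linear_bound:
  fixes f :: "real \<Rightarrow> real"
  assumes "0 < \<sigma>" "f \<in> borel_measurable borel" "\<And>x. \<bar>f x\<bar> \<le> a + b * \<bar>x\<bar>" "0 \<le> b"
  shows "integrable (gauss \<sigma> \<mu>) f"
proof (rule integrable_gauss_bound[OF assms(1,2)])
  show "\<bar>f x\<bar> \<le> (a + b) + b * x\<^sup>2" for x
    using assms(3)[of x] mult_left_mono[OF abs_le_one_plus_power2[of x] assms(4)]
    by (simp add: algebra_simps)
qed

lemma integral_gauss_shift:
  fixes f :: "real \<Rightarrow> real"
  assumes [measurable]: "f \<in> borel_measurable borel"
  shows "(\<integral>x. f x \<partial>gauss \<sigma> (t + \<mu>)) = (\<integral>x. f (t + x) \<partial>gauss \<sigma> \<mu>)"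
proof -
  have "(\<integral>x. normal_density (t + \<mu>) \<sigma> x * f x \<partial>lborel)
      = (\<integral>x. normal_density (t + \<mu>) \<sigma> (t + x) * f (t + x) \<partial>lborel)"
    by (subst lborel_integral_real_affine[where c = 1 and t = t]) auto
  also have "\<dots> = (\<integral>x. normal_density \<mu> \<sigma> x * f (t + x) \<partial>lborel)"
    by (simp add: normal_density_def)
  finally show ?thesis by (simp add: integral_gauss)
qed

text \<open>A nonnegative function with zero integral vanishes Lebesgue-almost everywhere, which
  positive values on a non-null set exclude. The strict inequalities between Gaussian integrals
  below are instances with a suitable witness \<open>A\<close>.\<close>

lemma integral_gauss_pos:
  fixes f :: "real \<Rightarrow> real"
  assumes "0 < \<sigma>" and f: "integrable (gauss \<sigma> \<mu>) f" and "\<And>x. 0 \<le> f x"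
    and A: "A \<in> sets borel" "0 < emeasure lborel A" and pos: "\<And>x. x \<in> A \<Longrightarrow> 0 < f x"
  shows "0 < (\<integral>x. f x \<partial>gauss \<sigma> \<mu>)"
proof -
  have "(\<integral>x. f x \<partial>gauss \<sigma> \<mu>) \<noteq> 0"
  proof
    assume "(\<integral>x. f x \<partial>gauss \<sigma> \<mu>) = 0"
    then have "AE x in gauss \<sigma> \<mu>. f x = 0"
      using integral_nonneg_eq_0_iff_AE[OF f] assms(3) by simp
    then have "AE x in lborel. f x = 0"
      using AE_gauss_iff[OF assms(1)] by simp
    then have "AE x in lborel. x \<notin> A"
      by eventually_elim (use pos in force)
    then have "emeasure lborel A = 0"
      using A(1) by (subst (asm) AE_iff_measurable[where N = A]) auto
    then show False using A(2) by simp
  qed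
  moreover have "0 \<le> (\<integral>x. f x \<partial>gauss \<sigma> \<mu>)"
    using assms(3) by (intro integral_nonneg_AE) simp
  ultimately show ?thesis by linarith
qed

section \<open>Integration against the joint law of the two draws\<close>

lemma sets_Psi [measurable_cong, simp]: "sets (Psi \<sigma> \<mu>1 \<mu>2 \<gamma>) = sets (borel \<Otimes>\<^sub>M borel)"
  unfolding Psi_def by (simp cong: sets_pair_measure_cong)

lemma space_Psi [simp]: "space (Psi \<sigma> \<mu>1 \<mu>2 \<gamma>) = UNIV"
  unfolding Psi_def by (simp add: space_pair_measure)

lemma measurable_Psi_density [measurable]:
  "(\<lambda>(x1, x2). normal_density \<mu>1 \<sigma> x1 * normal_density (\<mu>2 - \<gamma> * (x1 - \<mu>1)) \<sigma> x2)
    \<in> borel_measurable (borel \<Otimes>\<^sub>M borel)"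
  unfolding normal_density_def by measurable

lemma nn_integral_Psi:
  assumes [measurable]: "f \<in> borel_measurable (borel \<Otimes>\<^sub>M borel)"
  shows "(\<integral>\<^sup>+z. f z \<partial>Psi \<sigma> \<mu>1 \<mu>2 \<gamma>) = (\<integral>\<^sup>+x1. ennreal (normal_density \<mu>1 \<sigma> x1) *
    (\<integral>\<^sup>+x2. ennreal (normal_density (\<mu>2 - \<gamma> * (x1 - \<mu>1)) \<sigma> x2) * f (x1, x2) \<partial>lborel) \<partial>lborel)"
proof -
  have [measurable]: "f \<in> borel_measurable (lborel \<Otimes>\<^sub>M lborel)" by measurable
  have [measurable]: "(\<lambda>(x1, x2). ennreal (normal_density \<mu>1 \<sigma> x1 * normal_density (\<mu>2 - \<gamma> * (x1 - \<mu>1)) \<sigma> x2))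
      \<in> borel_measurable (lborel \<Otimes>\<^sub>M lborel)"
    unfolding normal_density_def by measurable
  have "(\<integral>\<^sup>+z. f z \<partial>Psi \<sigma> \<mu>1 \<mu>2 \<gamma>) = (\<integral>\<^sup>+x1. \<integral>\<^sup>+x2. ennreal (normal_density \<mu>1 \<sigma> x1 *
      normal_density (\<mu>2 - \<gamma> * (x1 - \<mu>1)) \<sigma> x2) * f (x1, x2) \<partial>lborel \<partial>lborel)"
    unfolding Psi_def
    by (subst nn_integral_density) (simp_all add: lborel.nn_integral_fst[symmetric])
  also have "\<dots> = (\<integral>\<^sup>+x1. ennreal (normal_density \<mu>1 \<sigma> x1) *
    (\<integral>\<^sup>+x2. ennreal (normal_density (\<mu>2 - \<gamma> * (x1 - \<mu>1)) \<sigma> x2) * f (x1, x2) \<partial>lborel) \<partial>lborel)"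
    by (simp add: ennreal_mult' nn_integral_cmult[symmetric] mult.assoc)
  finally show ?thesis .
qed

lemma prob_space_Psi:
  assumes "0 < \<sigma>"
  shows "prob_space (Psi \<sigma> \<mu>1 \<mu>2 \<gamma>)"
proof
  have one: "(\<integral>\<^sup>+x. ennreal (normal_density m \<sigma> x) \<partial>lborel) = 1" for m
    using assms by (simp add: nn_integral_eq_integral)
  have "emeasure (Psi \<sigma> \<mu>1 \<mu>2 \<gamma>) (space (Psi \<sigma> \<mu>1 \<mu>2 \<gamma>)) = (\<integral>\<^sup>+z. 1 \<partial>Psi \<sigma> \<mu>1 \<mu>2 \<gamma>)"
    by simp
  also have "\<dots> = 1"
    by (subst nn_integral_Psi) (simp_all add: one)
  finally show "emeasure (Psi \<sigma> \<mu>1 \<mu>2 \<gamma>) (space (Psi \<sigma> \<mu>1 \<mu>2 \<gamma>)) = 1" .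
qed

text \<open>Fubini under one quadratic growth condition, which covers both payoffs and
  log-likelihood ratios. The envelope \<open>1 + x\<^sup>2 + y\<^sup>2\<close> is integrable because
  the conditional second moment of the second draw is itself quadratic in the first.\<close>

lemma integral_Psi:
  fixes f :: "real \<times> real \<Rightarrow> real"
  assumes "0 < \<sigma>" and f [measurable]: "f \<in> borel_measurable (borel \<Otimes>\<^sub>M borel)"
    and bound: "\<And>x y. \<bar>f (x, y)\<bar> \<le> B * (1 + x\<^sup>2 + y\<^sup>2)"
  shows integrable_Psi_bound: "integrable (Psi \<sigma> \<mu>1 \<mu>2 \<gamma>) f"
    and integral_Psi_bound: "(\<integral>z. f z \<partial>Psi \<sigma> \<mu>1 \<mu>2 \<gamma>)
      = (\<integral>x. (\<integral>y. f (x, y) \<partial>gauss \<sigma> (\<mu>2 - \<gamma> * (x - \<mu>1))) \<partial>gauss \<sigma> \<mu>1)"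
proof -
  define w where "w = (\<lambda>(x, y). normal_density \<mu>1 \<sigma> x * normal_density (\<mu>2 - \<gamma> * (x - \<mu>1)) \<sigma> y)"
  have w [measurable]: "w \<in> borel_measurable (borel \<Otimes>\<^sub>M borel)"
    unfolding w_def by (rule measurable_Psi_density)
  have Psi_w: "Psi \<sigma> \<mu>1 \<mu>2 \<gamma> = density (lborel \<Otimes>\<^sub>M lborel) (\<lambda>z. ennreal (w z))"
    by (simp add: Psi_def w_def case_prod_unfold)
  have w0: "0 \<le> w z" for z by (simp add: w_def case_prod_unfold)
  define g :: "real \<times> real \<Rightarrow> real" where "g = (\<lambda>(x, y). 1 + x\<^sup>2 + y\<^sup>2)"
  have [measurable]: "g \<in> borel_measurable (borel \<Otimes>\<^sub>M borel)"
    unfolding g_def by measurable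
  have g0: "0 \<le> g z" for z by (simp add: g_def case_prod_unfold)
  have i2: "integrable (gauss \<sigma> m) (\<lambda>y. 1 + x\<^sup>2 + y\<^sup>2)" for m x
    using assms(1) by (intro Bochner_Integration.integrable_add) (auto simp: integrable_gauss_power2)
  have v2: "(\<integral>y. 1 + x\<^sup>2 + y\<^sup>2 \<partial>gauss \<sigma> m) = 1 + x\<^sup>2 + (m\<^sup>2 + \<sigma>\<^sup>2)" for m x
    using assms(1) by (simp add: integrable_gauss_power2 integral_gauss_power2)
  have inner: "(\<integral>y. norm (w (x, y) * g (x, y)) \<partial>lborel)
     = normal_density \<mu>1 \<sigma> x * (1 + x\<^sup>2 + ((\<mu>2 - \<gamma> * (x - \<mu>1))\<^sup>2 + \<sigma>\<^sup>2))" for x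
  proof -
    have "(\<integral>y. norm (w (x, y) * g (x, y)) \<partial>lborel)
      = (\<integral>y. normal_density \<mu>1 \<sigma> x * (normal_density (\<mu>2 - \<gamma> * (x - \<mu>1)) \<sigma> y * (1 + x\<^sup>2 + y\<^sup>2)) \<partial>lborel)"
      using w0 g0 by (intro Bochner_Integration.integral_cong) (auto simp: abs_mult w_def g_def)
    also have "\<dots> = normal_density \<mu>1 \<sigma> x * (\<integral>y. 1 + x\<^sup>2 + y\<^sup>2 \<partial>gauss \<sigma> (\<mu>2 - \<gamma> * (x - \<mu>1)))"
      by (simp add: integral_gauss)
    finally show ?thesis by (simp add: v2)
  qed
  have iwg: "integrable (lborel \<Otimes>\<^sub>M lborel) (\<lambda>z. w z * g z)"
  proof (rule lborel_pair.Fubini_integrable)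
    show "(\<lambda>z. w z * g z) \<in> borel_measurable (lborel \<Otimes>\<^sub>M lborel)" by measurable
    have "integrable (gauss \<sigma> \<mu>1) (\<lambda>x. 1 + x\<^sup>2 + ((\<mu>2 - \<gamma> * (x - \<mu>1))\<^sup>2 + \<sigma>\<^sup>2))"
    proof -
      \<comment> \<open>Collecting powers of \<open>x\<close> reduces integrability to the first two
        moments.\<close>
      have "(\<lambda>x. 1 + x\<^sup>2 + ((\<mu>2 - \<gamma> * (x - \<mu>1))\<^sup>2 + \<sigma>\<^sup>2))
        = (\<lambda>x. (1 + (\<mu>2 + \<gamma> * \<mu>1)\<^sup>2 + \<sigma>\<^sup>2) + (1 + \<gamma>\<^sup>2) * x\<^sup>2 - 2 * \<gamma> * (\<mu>2 + \<gamma> * \<mu>1) * x)"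
        by (auto simp: power2_eq_square algebra_simps)
      then show ?thesis
        using assms(1)
        by (simp only:) (intro Bochner_Integration.integrable_add Bochner_Integration.integrable_diff
            Bochner_Integration.integrable_mult_right; simp add: integrable_gauss_power2)
    qed
    then show "integrable lborel (\<lambda>x. \<integral>y. norm (w (x, y) * g (x, y)) \<partial>lborel)"
      unfolding inner by (simp add: integrable_gauss_iff)
    have "integrable lborel (\<lambda>y. normal_density \<mu>1 \<sigma> x * (normal_density (\<mu>2 - \<gamma> * (x - \<mu>1)) \<sigma> y * (1 + x\<^sup>2 + y\<^sup>2)))" for x
      using i2[where m = "\<mu>2 - \<gamma> * (x - \<mu>1)" and x = x]
      by (intro Bochner_Integration.integrable_mult_right) (simp add: integrable_gauss_iff)
    then show "AE x in lborel. integrable lborel (\<lambda>y. w (x, y) * g (x, y))"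
      by (simp add: w_def g_def mult.assoc)
  qed
  have iwf: "integrable (lborel \<Otimes>\<^sub>M lborel) (\<lambda>z. w z * f z)"
  proof (rule Bochner_Integration.integrable_bound)
    show "integrable (lborel \<Otimes>\<^sub>M lborel) (\<lambda>z. B * (w z * g z))" using iwg by simp
    show "(\<lambda>z. w z * f z) \<in> borel_measurable (lborel \<Otimes>\<^sub>M lborel)" by measurable
    have "\<bar>w z * f z\<bar> \<le> \<bar>B * (w z * g z)\<bar>" for z
    proof -
      have "\<bar>f z\<bar> \<le> B * g z" using bound[of "fst z" "snd z"] by (simp add: g_def case_prod_unfold)
      then have "w z * \<bar>f z\<bar> \<le> w z * (B * g z)" using w0 by (rule mult_left_mono)
      then have "\<bar>w z * f z\<bar> \<le> B * (w z * g z)" using w0[of z] by (simp add: abs_mult mult.left_commute)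
      then show ?thesis by linarith
    qed
    then show "AE z in lborel \<Otimes>\<^sub>M lborel. norm (w z * f z) \<le> norm (B * (w z * g z))" by simp
  qed
  have f': "f \<in> borel_measurable (lborel \<Otimes>\<^sub>M lborel)" and w': "w \<in> borel_measurable (lborel \<Otimes>\<^sub>M lborel)"
    by measurable
  show "integrable (Psi \<sigma> \<mu>1 \<mu>2 \<gamma>) f"
    unfolding Psi_w using iwf w0 f' w' by (subst integrable_density) auto
  have "(\<integral>z. f z \<partial>Psi \<sigma> \<mu>1 \<mu>2 \<gamma>) = (\<integral>z. w z * f z \<partial>(lborel \<Otimes>\<^sub>M lborel))"
    unfolding Psi_w using w0 f' w' by (subst integral_density) auto
  also have "\<dots> = (\<integral>x. \<integral>y. w (x, y) * f (x, y) \<partial>lborel \<partial>lborel)"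
    using lborel_pair.integral_fst'[OF iwf] by simp
  also have "\<dots> = (\<integral>x. normal_density \<mu>1 \<sigma> x * (\<integral>y. normal_density (\<mu>2 - \<gamma> * (x - \<mu>1)) \<sigma> y * f (x, y) \<partial>lborel) \<partial>lborel)"
    by (simp add: w_def mult.assoc)
  also have "\<dots> = (\<integral>x. (\<integral>y. normal_density (\<mu>2 - \<gamma> * (x - \<mu>1)) \<sigma> y * f (x, y) \<partial>lborel) \<partial>gauss \<sigma> \<mu>1)"
  proof (rule integral_gauss[symmetric])
    have "(\<lambda>(x, y). normal_density (\<mu>2 - \<gamma> * (x - \<mu>1)) \<sigma> y * f (x, y)) \<in> borel_measurable (borel \<Otimes>\<^sub>M lborel)"
      unfolding normal_density_def by measurable
    then show "(\<lambda>x. \<integral>y. normal_density (\<mu>2 - \<gamma> * (x - \<mu>1)) \<sigma> y * f (x, y) \<partial>lborel) \<in> borel_measurable borel"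
      by (rule lborel.borel_measurable_lebesgue_integral)
  qed
  also have "\<dots> = (\<integral>x. (\<integral>y. f (x, y) \<partial>gauss \<sigma> (\<mu>2 - \<gamma> * (x - \<mu>1))) \<partial>gauss \<sigma> \<mu>1)"
    by (subst integral_gauss) auto
  finally show "(\<integral>z. f z \<partial>Psi \<sigma> \<mu>1 \<mu>2 \<gamma>)
      = (\<integral>x. (\<integral>y. f (x, y) \<partial>gauss \<sigma> (\<mu>2 - \<gamma> * (x - \<mu>1))) \<partial>gauss \<sigma> \<mu>1)" .
qed

section \<open>Optimal strategies\<close>

text \<open>The expected improvement: if the second draw is normal with mean \<open>x1 + t\<close>,
  this is the mean of the positive part of \<open>x2 - x1\<close>. The estimates below rest on its
  being nondecreasing, 1-Lipschitz and strictly above the identity.\<close>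

definition overshoot :: "real \<Rightarrow> real \<Rightarrow> real" where
  "overshoot \<sigma> t = (\<integral>z. max 0 (t + z) \<partial>gauss \<sigma> 0)"

lemma integrable_max_0_add: "0 < \<sigma> \<Longrightarrow> integrable (gauss \<sigma> 0) (\<lambda>z. max 0 (t + z))"
  by (rule integrable_gauss_linear_bound[where a = "\<bar>t\<bar>" and b = 1]) auto

lemma overshoot_mono:
  assumes "0 < \<sigma>" "t \<le> s"
  shows "overshoot \<sigma> t \<le> overshoot \<sigma> s"
  unfolding overshoot_def
  using assms by (intro integral_mono integrable_max_0_add) auto

lemma overshoot_increment_le:
  assumes "0 < \<sigma>" "t \<le> s"
  shows "overshoot \<sigma> s \<le> overshoot \<sigma> t + (s - t)"
proof -
  have "overshoot \<sigma> s \<le> (\<integral>z. max 0 (t + z) + (s - t) \<partial>gauss \<sigma> 0)"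
    unfolding overshoot_def
    using assms by (intro integral_mono integrable_max_0_add Bochner_Integration.integrable_add) auto
  also have "\<dots> = overshoot \<sigma> t + (s - t)"
    using assms integrable_max_0_add[OF assms(1), of t] by (simp add: overshoot_def)
  finally show ?thesis .
qed

text \<open>The difference \<open>max 0 (t + z) - (t + z)\<close> is the positive part of
  \<open>- (t + z)\<close>, which is positive on the unit interval just below
  \<open>- t\<close>.\<close>

lemma less_overshoot:
  assumes "0 < \<sigma>"
  shows "t < overshoot \<sigma> t"
proof -
  have "0 < (\<integral>z. max 0 (t + z) - (t + z) \<partial>gauss \<sigma> 0)"
    using assms
    by (intro integral_gauss_pos[where A = "{- t - 1<..<- t}"] Bochner_Integration.integrable_diff
        integrable_max_0_add Bochner_Integration.integrable_add) auto
  also have "\<dots> = overshoot \<sigma> t - t"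
    using assms integrable_max_0_add[OF assms, of t] by (simp add: overshoot_def)
  finally show ?thesis by simp
qed

text \<open>The expected gain from continuing rather than stopping, gross of \<open>\<kappa>\<close>, when the conditional mean
  of \<open>X\<^sub>2\<close> exceeds \<open>x\<^sub>1\<close> by \<open>t\<close>.\<close>
definition gain :: "real \<Rightarrow> real \<Rightarrow> real \<Rightarrow> real" where
  "gain \<sigma> q t = q * overshoot \<sigma> t + (1 - q) * t"

text \<open>Strictness comes from the linear term, whose weight \<open>1 - q\<close> is positive;
  the overshoot term enters only as nondecreasing.\<close>

lemma gain_strict_mono:
  assumes "0 < \<sigma>" "0 \<le> q" "q < 1" "t < s"
  shows "gain \<sigma> q t < gain \<sigma> q s"
proof -
  have "q * overshoot \<sigma> t \<le> q * overshoot \<sigma> s"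
    using overshoot_mono[OF assms(1), of t s] assms by (intro mult_left_mono) auto
  moreover have "(1 - q) * t < (1 - q) * s"
    using assms by (intro mult_strict_left_mono) auto
  ultimately show ?thesis by (simp add: gain_def)
qed

lemma gain_less_iff:
  assumes "0 < \<sigma>" "0 \<le> q" "q < 1"
  shows "gain \<sigma> q t < gain \<sigma> q s \<longleftrightarrow> t < s"
  using gain_strict_mono[OF assms, of t s] gain_strict_mono[OF assms, of s t]
  by (cases t s rule: linorder_cases) auto

lemma gain_eqD:
  assumes "0 < \<sigma>" "0 \<le> q" "q < 1" "gain \<sigma> q t = gain \<sigma> q s"
  shows "t = s"
  using gain_less_iff[OF assms(1-3), of t s] gain_less_iff[OF assms(1-3), of s t] assms(4) by simp

text \<open>The two gains differ by \<open>(q' - q) * (overshoot \<sigma> t - t)\<close>. This is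
  the source of the comparative statics in \<open>q\<close>.\<close>

lemma gain_less_gain:
  assumes "0 < \<sigma>" "q < q'"
  shows "gain \<sigma> q t < gain \<sigma> q' t"
proof -
  have "0 < (q' - q) * (overshoot \<sigma> t - t)"
    using less_overshoot[OF assms(1), of t] assms(2) by (intro mult_pos_pos) auto
  then show ?thesis by (simp add: gain_def algebra_simps)
qed

lemma continuous_overshoot:
  assumes "0 < \<sigma>"
  shows "continuous_on UNIV (overshoot \<sigma>)"
proof (rule lipschitz_on_continuous_on[where L = 1], rule lipschitz_onI)
  fix x y :: real
  show "dist (overshoot \<sigma> x) (overshoot \<sigma> y) \<le> 1 * dist x y"
    using overshoot_mono[OF assms, of x y] overshoot_increment_le[OF assms, of x y]
      overshoot_mono[OF assms, of y x] overshoot_increment_le[OF assms, of y x]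
    by (cases "x \<le> y") (auto simp: dist_real_def)
qed simp

lemma continuous_gain: "0 < \<sigma> \<Longrightarrow> continuous_on A (gain \<sigma> q)"
  unfolding gain_def
  by (intro continuous_intros continuous_on_subset[OF continuous_overshoot]) auto

lemma abs_gain_le:
  assumes "0 < \<sigma>" "0 \<le> q" "q < 1"
  shows "\<bar>gain \<sigma> q t\<bar> \<le> \<bar>overshoot \<sigma> 0\<bar> + \<bar>t\<bar>"
proof -
  have "\<bar>overshoot \<sigma> t\<bar> \<le> \<bar>overshoot \<sigma> 0\<bar> + \<bar>t\<bar>"
    using overshoot_mono[OF assms(1), of 0 t] overshoot_increment_le[OF assms(1), of 0 t]
      overshoot_mono[OF assms(1), of t 0] overshoot_increment_le[OF assms(1), of t 0]
    by (cases "0 \<le> t") auto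
  then have "q * \<bar>overshoot \<sigma> t\<bar> \<le> q * (\<bar>overshoot \<sigma> 0\<bar> + \<bar>t\<bar>)"
    using assms(2) by (rule mult_left_mono)
  moreover have "q * \<bar>overshoot \<sigma> 0\<bar> \<le> 1 * \<bar>overshoot \<sigma> 0\<bar>"
    using assms by (intro mult_right_mono) auto
  moreover have "\<bar>gain \<sigma> q t\<bar> \<le> q * \<bar>overshoot \<sigma> t\<bar> + (1 - q) * \<bar>t\<bar>"
    using abs_triangle_ineq[of "q * overshoot \<sigma> t" "(1 - q) * t"] assms
    by (simp add: gain_def abs_mult)
  ultimately show ?thesis by (simp add: algebra_simps)
qed

lemma ex_gain_eq:
  assumes "0 < \<sigma>" "0 \<le> q" "q < 1"
  obtains t where "gain \<sigma> q t = \<kappa>"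
proof -
  \<comment> \<open>For \<open>t \<le> 0\<close> the overshoot is at most its value at 0, so the
    gain lies below an affine function; the quotient is where that function equals
    \<open>\<kappa>\<close>. The inner minimum with \<open>\<kappa>\<close> orders the end points,
    and \<open>\<kappa>\<close> itself serves as the upper one because the overshoot exceeds the
    identity.\<close>
  define lo where "lo = min 0 (min \<kappa> ((\<kappa> - q * overshoot \<sigma> 0) / (1 - q)))"
  have "gain \<sigma> q lo \<le> \<kappa>"
  proof -
    have "q * overshoot \<sigma> lo \<le> q * overshoot \<sigma> 0"
      using overshoot_mono[OF assms(1), of lo 0] assms by (intro mult_left_mono) (auto simp: lo_def)
    moreover have "(1 - q) * lo \<le> (1 - q) * ((\<kappa> - q * overshoot \<sigma> 0) / (1 - q))"
      using assms by (intro mult_left_mono) (auto simp: lo_def)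
    ultimately show ?thesis using assms by (simp add: gain_def)
  qed
  moreover have "\<kappa> \<le> gain \<sigma> q \<kappa>"
    using mult_left_mono[OF less_imp_le[OF less_overshoot[OF assms(1), of \<kappa>]] assms(2)]
    by (simp add: gain_def algebra_simps)
  moreover have "lo \<le> \<kappa>" by (simp add: lo_def)
  ultimately obtain t where "gain \<sigma> q t = \<kappa>"
    using IVT'[of "gain \<sigma> q" lo \<kappa> \<kappa>] continuous_gain[OF assms(1), of _ q] by blast
  then show ?thesis by (rule that)
qed

text \<open>Writing \<open>max x y\<close> as \<open>x + max 0 (y - x)\<close> and centering the
  Gaussian splits off the stopping payoff \<open>x\<close>. The sign of the remaining term decides
  which action is better at \<open>x\<close>.\<close>

lemma integral_u2:
  assumes "0 < \<sigma>"
  shows "(\<integral>y. u2 q \<kappa> x y \<partial>gauss \<sigma> m) = x + (gain \<sigma> q (m - x) - \<kappa>)"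
proof -
  have "(\<integral>y. u2 q \<kappa> x y \<partial>gauss \<sigma> m) = (\<integral>z. u2 q \<kappa> x (m + z) \<partial>gauss \<sigma> 0)"
    using integral_gauss_shift[of "u2 q \<kappa> x" \<sigma> m 0] by (simp add: u2_def[abs_def])
  also have "\<dots> = (\<integral>z. q * max 0 ((m - x) + z) + (1 - q) * z + (q * x + (1 - q) * m - \<kappa>) \<partial>gauss \<sigma> 0)"
  proof (intro Bochner_Integration.integral_cong refl)
    fix z
    have "max x (m + z) = x + max 0 ((m - x) + z)" by auto
    then show "u2 q \<kappa> x (m + z) = q * max 0 ((m - x) + z) + (1 - q) * z + (q * x + (1 - q) * m - \<kappa>)"
      unfolding u2_def by (simp only:) (simp add: algebra_simps)
  qed
  also have "\<dots> = q * overshoot \<sigma> (m - x) + (q * x + (1 - q) * m - \<kappa>)"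
    using assms integrable_max_0_add[OF assms, of "m - x"] by (simp add: overshoot_def)
  finally show ?thesis by (simp add: gain_def algebra_simps)
qed

text \<open>The growth bound required by \<open>integral_Psi\<close>; either action has a payoff of
  at most linear growth.\<close>

lemma abs_payoff_le:
  assumes "0 \<le> q" "q < 1"
  shows "\<bar>payoff q \<kappa> S (x, y)\<bar> \<le> (3 + \<bar>\<kappa>\<bar>) * (1 + x\<^sup>2 + y\<^sup>2)"
proof -
  have "\<bar>q * max x y + (1 - q) * y\<bar> \<le> \<bar>x\<bar> + \<bar>y\<bar>"
  proof -
    have "\<bar>q * max x y + (1 - q) * y\<bar> \<le> q * \<bar>max x y\<bar> + (1 - q) * \<bar>y\<bar>"
      using abs_triangle_ineq[of "q * max x y" "(1 - q) * y"] assms by (simp add: abs_mult)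
    also have "\<dots> \<le> q * (\<bar>x\<bar> + \<bar>y\<bar>) + (1 - q) * (\<bar>x\<bar> + \<bar>y\<bar>)"
      using assms by (intro add_mono mult_left_mono) auto
    finally show ?thesis by (simp add: algebra_simps)
  qed
  then have "\<bar>payoff q \<kappa> S (x, y)\<bar> \<le> \<bar>x\<bar> + \<bar>y\<bar> + \<bar>\<kappa>\<bar>"
    by (auto simp: payoff_def u1_def u2_def split: action.splits)
  also have "\<dots> \<le> 3 * (1 + x\<^sup>2 + y\<^sup>2) + \<bar>\<kappa>\<bar> * (1 + x\<^sup>2 + y\<^sup>2)"
  proof (rule add_mono)
    show "\<bar>x\<bar> + \<bar>y\<bar> \<le> 3 * (1 + x\<^sup>2 + y\<^sup>2)"
      using abs_le_one_plus_power2[of x] abs_le_one_plus_power2[of y]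
        zero_le_power2[of x] zero_le_power2[of y] unfolding distrib_left by linarith
    show "\<bar>\<kappa>\<bar> \<le> \<bar>\<kappa>\<bar> * (1 + x\<^sup>2 + y\<^sup>2)"
      using mult_left_mono[of 1 "1 + x\<^sup>2 + y\<^sup>2" "\<bar>\<kappa>\<bar>"] by simp
  qed
  finally show ?thesis by (simp add: algebra_simps)
qed

lemma sets_Continue:
  assumes "S \<in> strategies"
  shows "{x. S x = Continue} \<in> sets borel"
proof -
  have "S -` {Continue} \<inter> space borel \<in> sets borel"
    using assms unfolding strategies_def by (rule measurable_sets) simp
  then show ?thesis by (simp add: vimage_def)
qed

lemma measurable_payoff:
  assumes "S \<in> strategies"
  shows "payoff q \<kappa> S \<in> borel_measurable (borel \<Otimes>\<^sub>M borel)"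
proof -
  have [measurable]: "{x. S x = Continue} \<in> sets borel" by (rule sets_Continue[OF assms])
  have "payoff q \<kappa> S = (\<lambda>z. if fst z \<in> {x. S x = Continue} then u2 q \<kappa> (fst z) (snd z) else fst z)"
    by (auto simp: payoff_def u1_def fun_eq_iff split: action.splits)
  also have "\<dots> \<in> borel_measurable (borel \<Otimes>\<^sub>M borel)"
    unfolding u2_def by measurable
  finally show ?thesis .
qed

definition cutoff_strategy :: "real \<Rightarrow> real \<Rightarrow> action" where
  "cutoff_strategy c x = (if x < c then Continue else Stop)"

lemma cutoff_strategy_in_strategies: "cutoff_strategy c \<in> strategies"
  unfolding strategies_def cutoff_strategy_def[abs_def] by measurable

lemma has_cutoff_cutoff_strategy: "has_cutoff (cutoff_strategy c) c"
  by (simp add: has_cutoff_def cutoff_strategy_def)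

text \<open>Two different cutoffs would prescribe different actions on the whole open interval
  between them, which is not a null set.\<close>

lemma has_cutoff_unique:
  assumes "has_cutoff S c" "has_cutoff S c'"
  shows "c = c'"
proof -
  have "\<not> a < b" if "has_cutoff S a" "has_cutoff S b" for a b
  proof
    assume "a < b"
    have "AE x in lborel. x \<notin> {a<..<b}"
      using that unfolding has_cutoff_def by eventually_elim auto
    then have "emeasure lborel {a<..<b} = 0"
      by (subst (asm) AE_iff_measurable[where N = "{a<..<b}"]) auto
    then show False using \<open>a < b\<close> by simp
  qed
  then show ?thesis using assms by (meson linorder_neqE_linordered_idom)
qed

text \<open>By Fubini the payoff is the mean of \<open>x\<close> plus the net gain over the
  continuation region, so continuing exactly where the net gain is positive is best pointwise. The
  shortfall of any other strategy is the integral of a nonnegative function, which is zero only if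
  the two strategies agree almost everywhere.\<close>

lemma optimal_strategy_iff:
  assumes "0 < \<sigma>" "0 \<le> q" "q < 1" "0 < 1 + \<gamma>"
    and c: "gain \<sigma> q (\<mu>2 + \<gamma> * \<mu>1 - (1 + \<gamma>) * c) = \<kappa>"
  shows "optimal_strategy q \<kappa> (Psi \<sigma> \<mu>1 \<mu>2 \<gamma>) S \<longleftrightarrow> S \<in> strategies \<and> has_cutoff S c"
proof -
  define D where "D x = gain \<sigma> q (\<mu>2 + \<gamma> * \<mu>1 - (1 + \<gamma>) * x) - \<kappa>" for x
  \<comment> \<open>The argument of \<open>gain\<close> decreases strictly in \<open>x\<close>
    because \<open>0 < 1 + \<gamma>\<close>, so the net gain changes sign exactly once, at
    \<open>c\<close>.\<close>
  have D_pos: "0 < D x \<longleftrightarrow> x < c" and D_neg: "D x < 0 \<longleftrightarrow> c < x" for x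
    unfolding D_def c[symmetric] using assms(4) by (simp_all add: gain_less_iff[OF assms(1-3)])
  have D_meas [measurable]: "D \<in> borel_measurable borel"
    unfolding D_def
    by (intro borel_measurable_continuous_onI continuous_intros
        continuous_on_compose2[OF continuous_gain[OF assms(1), of UNIV]]) auto
  define a where "a = \<bar>overshoot \<sigma> 0\<bar> + \<bar>\<mu>2 + \<gamma> * \<mu>1\<bar> + \<bar>\<kappa>\<bar>"
  have D_bound: "\<bar>D x\<bar> \<le> a + (1 + \<gamma>) * \<bar>x\<bar>" for x
  proof -
    have "\<bar>(1 + \<gamma>) * x\<bar> = (1 + \<gamma>) * \<bar>x\<bar>" using assms(4) by (simp add: abs_mult)
    then show ?thesis
      using abs_gain_le[OF assms(1-3), of "\<mu>2 + \<gamma> * \<mu>1 - (1 + \<gamma>) * x"]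
      unfolding D_def a_def by linarith
  qed
  define W where "W S x = x + indicator {x. S x = Continue} x * D x" for S and x :: real
  let ?P = "\<lambda>S. \<integral>z. payoff q \<kappa> S z \<partial>Psi \<sigma> \<mu>1 \<mu>2 \<gamma>"
  have P_eq: "?P S = (\<integral>x. W S x \<partial>gauss \<sigma> \<mu>1)" if "S \<in> strategies" for S
  proof -
    have "(\<integral>y. payoff q \<kappa> S (x, y) \<partial>gauss \<sigma> (\<mu>2 - \<gamma> * (x - \<mu>1))) = W S x" for x
    proof (cases "S x")
      case Stop
      then show ?thesis using assms(1) by (simp add: payoff_def u1_def W_def)
    next
      case Continue
      have eq: "\<mu>2 - \<gamma> * (x - \<mu>1) - x = \<mu>2 + \<gamma> * \<mu>1 - (1 + \<gamma>) * x" by (simp add: algebra_simps)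
      show ?thesis
        using Continue integral_u2[OF assms(1), where q = q and \<kappa> = \<kappa> and x = x and m = "\<mu>2 - \<gamma> * (x - \<mu>1)"]
        unfolding eq by (simp add: payoff_def W_def D_def)
    qed
    then show ?thesis
      using integral_Psi_bound[OF assms(1) measurable_payoff[OF that] abs_payoff_le[OF assms(2,3)]]
      by simp
  qed
  have W_int: "integrable (gauss \<sigma> \<mu>1) (W S)" if "S \<in> strategies" for S
  proof (rule integrable_gauss_linear_bound[OF assms(1), where a = a and b = "1 + (1 + \<gamma>)"])
    have [measurable]: "{x. S x = Continue} \<in> sets borel" by (rule sets_Continue[OF that])
    show "W S \<in> borel_measurable borel" unfolding W_def by measurable
    have "0 \<le> a" by (simp add: a_def)
    then have "\<bar>indicator {x. S x = Continue} x * D x\<bar> \<le> a + (1 + \<gamma>) * \<bar>x\<bar>" for x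
      using D_bound[of x] assms(4) by (auto simp: indicator_def)
    then have "\<bar>W S x\<bar> \<le> \<bar>x\<bar> + (a + (1 + \<gamma>) * \<bar>x\<bar>)" for x
      unfolding W_def using abs_triangle_ineq[of x "indicator {x. S x = Continue} x * D x"]
      by (meson add_left_mono order_trans)
    then show "\<bar>W S x\<bar> \<le> a + (1 + (1 + \<gamma>)) * \<bar>x\<bar>" for x
      by (simp add: algebra_simps)
    show "0 \<le> 1 + (1 + \<gamma>)" using assms(4) by simp
  qed
  define C where "C = cutoff_strategy c"
  have C: "C \<in> strategies" unfolding C_def by (rule cutoff_strategy_in_strategies)
  have gap0: "0 \<le> W C x - W S x" for S x
    using D_pos[of x] D_neg[of x]
    by (auto simp: W_def C_def cutoff_strategy_def indicator_def)
  have diff: "?P C - ?P S = (\<integral>x. W C x - W S x \<partial>gauss \<sigma> \<mu>1)" if "S \<in> strategies" for S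
    using P_eq[OF C] P_eq[OF that] W_int[OF C] W_int[OF that] by simp
  have le: "?P S \<le> ?P C" if "S \<in> strategies" for S
    using diff[OF that] gap0[of _ S] by (smt (verit) Bochner_Integration.integral_nonneg)
  have eq_iff: "?P C = ?P S \<longleftrightarrow> has_cutoff S c" if "S \<in> strategies" for S
  proof -
    have "?P C = ?P S \<longleftrightarrow> (\<integral>x. W C x - W S x \<partial>gauss \<sigma> \<mu>1) = 0"
      using diff[OF that] by linarith
    also have "\<dots> \<longleftrightarrow> (AE x in gauss \<sigma> \<mu>1. W C x - W S x = 0)"
      using W_int[OF C] W_int[OF that] gap0 by (intro integral_nonneg_eq_0_iff_AE) auto
    also have "\<dots> \<longleftrightarrow> (AE x in lborel. W C x - W S x = 0)"
      by (rule AE_gauss_iff[OF assms(1)])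
    also have "\<dots> \<longleftrightarrow> (AE x in lborel. S x = Stop \<longleftrightarrow> c \<le> x)"
    proof -
      \<comment> \<open>At \<open>x = c\<close> the net gain vanishes and the actions tie, so the
        equivalence can only be claimed off this null set.\<close>
      have *: "W C x - W S x = 0 \<longleftrightarrow> (S x = Stop \<longleftrightarrow> c \<le> x)" if "x \<noteq> c" for x
        using that D_pos[of x] D_neg[of x]
        by (cases "S x"; cases "x < c") (auto simp: W_def C_def cutoff_strategy_def)
      have "AE x in lborel. x \<noteq> c" by (rule AE_lborel_singleton)
      then have "AE x in lborel. W C x - W S x = 0 \<longleftrightarrow> (S x = Stop \<longleftrightarrow> c \<le> x)"
        by eventually_elim (rule *)
      then show ?thesis by (rule eventually_subst)
    qed
    finally show ?thesis unfolding has_cutoff_def .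
  qed
  show ?thesis
  proof
    assume "optimal_strategy q \<kappa> (Psi \<sigma> \<mu>1 \<mu>2 \<gamma>) S"
    then have S: "S \<in> strategies" and "?P C \<le> ?P S"
      using C by (auto simp: optimal_strategy_def)
    then show "S \<in> strategies \<and> has_cutoff S c"
      using eq_iff[OF S] le[OF S] by auto
  next
    assume "S \<in> strategies \<and> has_cutoff S c"
    then show "optimal_strategy q \<kappa> (Psi \<sigma> \<mu>1 \<mu>2 \<gamma>) S"
      using eq_iff[of S] le by (auto simp: optimal_strategy_def)
  qed
qed

section \<open>Conditional means of truncated Gaussians\<close>

text \<open>For a null set \<open>C\<close> the quotient is 0 by the convention for
  division.\<close>

definition cond_mean :: "real \<Rightarrow> real \<Rightarrow> real set \<Rightarrow> real" where
  "cond_mean \<sigma> \<mu> C = (\<integral>x. indicator C x * x \<partial>gauss \<sigma> \<mu>) / measure (gauss \<sigma> \<mu>) C"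

lemma measure_gauss_pos:
  assumes "0 < \<sigma>" "C \<in> sets borel" "0 < emeasure lborel C"
  shows "0 < measure (gauss \<sigma> \<mu>) C"
proof -
  have "0 < (\<integral>x. (indicator C x :: real) \<partial>gauss \<sigma> \<mu>)"
    using assms
    by (intro integral_gauss_pos[where A = C] integrable_gauss_linear_bound[where a = 1 and b = 0])
      (auto simp: indicator_def)
  then show ?thesis by simp
qed

text \<open>Comparing a conditional mean with a number \<open>a\<close> becomes determining the sign
  of an integral, so that later arguments avoid quotients.\<close>

lemma integral_indicator_diff_cond_mean:
  assumes "0 < \<sigma>" "C \<in> sets borel" "0 < emeasure lborel C"
  shows "(\<integral>x. indicator C x * (x - a) \<partial>gauss \<sigma> \<mu>) = measure (gauss \<sigma> \<mu>) C * (cond_mean \<sigma> \<mu> C - a)"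
proof -
  have i: "integrable (gauss \<sigma> \<mu>) (\<lambda>x. indicator C x * x)"
    "integrable (gauss \<sigma> \<mu>) (\<lambda>x. indicator C x * a)"
    using assms(1,2)
    by (intro integrable_gauss_linear_bound[where a = "\<bar>a\<bar>" and b = 1]; simp add: indicator_def)+
  have "(\<integral>x. indicator C x * (x - a) \<partial>gauss \<sigma> \<mu>) = (\<integral>x. indicator C x * x - indicator C x * a \<partial>gauss \<sigma> \<mu>)"
    by (simp add: right_diff_distrib)
  also have "\<dots> = (\<integral>x. indicator C x * x \<partial>gauss \<sigma> \<mu>) - measure (gauss \<sigma> \<mu>) C * a"
    by (subst Bochner_Integration.integral_diff[OF i]) simp
  also have "(\<integral>x. indicator C x * x \<partial>gauss \<sigma> \<mu>) = measure (gauss \<sigma> \<mu>) C * cond_mean \<sigma> \<mu> C"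
    using measure_gauss_pos[OF assms, of \<mu>] by (simp add: cond_mean_def)
  finally show ?thesis by (simp only: right_diff_distrib)
qed

lemma emeasure_lborel_lessThan_pos: "0 < emeasure lborel {..<c :: real}"
proof -
  have "0 < emeasure lborel {c - 1<..<c}" by simp
  also have "\<dots> \<le> emeasure lborel {..<c}" by (rule emeasure_mono) auto
  finally show ?thesis .
qed

lemmas integral_lessThan_diff =
  integral_indicator_diff_cond_mean[OF _ _ emeasure_lborel_lessThan_pos, simplified]

lemma measure_gauss_lessThan_pos: "0 < \<sigma> \<Longrightarrow> 0 < measure (gauss \<sigma> \<mu>) {..<c}"
  by (rule measure_gauss_pos) (auto simp: emeasure_lborel_lessThan_pos)

lemma integrable_indicator_diff:
  assumes "0 < \<sigma>" "C \<in> sets borel"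
  shows "integrable (gauss \<sigma> \<mu>) (\<lambda>x. indicator C x * (x - a))"
  using assms
  by (intro integrable_gauss_linear_bound[where a = "\<bar>a\<bar>" and b = 1]) (auto simp: indicator_def)

lemma cond_mean_less_bound:
  assumes "0 < \<sigma>"
  shows "cond_mean \<sigma> \<mu> {..<c} < c"
proof -
  have "0 < (\<integral>x. - (indicator {..<c} x * (x - c)) \<partial>gauss \<sigma> \<mu>)"
    using assms
    by (intro integral_gauss_pos[where A = "{..<c}"] Bochner_Integration.integrable_minus
        integrable_indicator_diff emeasure_lborel_lessThan_pos) (auto simp: indicator_def)
  then have "measure (gauss \<sigma> \<mu>) {..<c} * (cond_mean \<sigma> \<mu> {..<c} - c) < 0"
    by (simp add: integral_lessThan_diff[OF assms])
  then show ?thesis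
    using measure_gauss_lessThan_pos[OF assms, of \<mu> c] by (simp add: mult_less_0_iff)
qed

text \<open>The deviation \<open>x - \<mu>\<close> integrates to zero in total. For
  \<open>c > \<mu>\<close> its part on \<open>{c..}\<close> is positive, so its part on
  \<open>{..<c}\<close> is negative; for smaller \<open>c\<close> the bound by \<open>c\<close>
  suffices.\<close>

lemma cond_mean_less_mean:
  assumes "0 < \<sigma>"
  shows "cond_mean \<sigma> \<mu> {..<c} < \<mu>"
proof (cases "c \<le> \<mu>")
  case True
  then show ?thesis using cond_mean_less_bound[OF assms, of \<mu> c] by simp
next
  case False
  have "0 < (\<integral>x. indicator {c..} x * (x - \<mu>) \<partial>gauss \<sigma> \<mu>)"
    using assms False
    by (intro integral_gauss_pos[where A = "{c<..<c + 1}"] integrable_indicator_diff)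
      (auto simp: indicator_def)
  also have "\<dots> = (\<integral>x. (x - \<mu>) - indicator {..<c} x * (x - \<mu>) \<partial>gauss \<sigma> \<mu>)"
    by (intro Bochner_Integration.integral_cong) (auto simp: indicator_def)
  also have "\<dots> = - (\<integral>x. indicator {..<c} x * (x - \<mu>) \<partial>gauss \<sigma> \<mu>)"
    using assms integrable_indicator_diff[OF assms, of "{..<c}" \<mu> \<mu>] by simp
  finally have "measure (gauss \<sigma> \<mu>) {..<c} * (cond_mean \<sigma> \<mu> {..<c} - \<mu>) < 0"
    by (simp add: integral_lessThan_diff[OF assms])
  then show ?thesis
    using measure_gauss_lessThan_pos[OF assms, of \<mu> c] by (simp add: mult_less_0_iff)
qed

text \<open>Enlarging the half-line adds mass only at points above the old conditional mean
  \<open>e\<close>, which lies below \<open>c\<close>.\<close>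

lemma strict_mono_cond_mean:
  assumes "0 < \<sigma>" "c < c'"
  shows "cond_mean \<sigma> \<mu> {..<c} < cond_mean \<sigma> \<mu> {..<c'}"
proof -
  define e where "e = cond_mean \<sigma> \<mu> {..<c}"
  have e: "e < c" unfolding e_def by (rule cond_mean_less_bound[OF assms(1)])
  have "0 < (\<integral>x. indicator {c..<c'} x * (x - e) \<partial>gauss \<sigma> \<mu>)"
    using assms e
    by (intro integral_gauss_pos[where A = "{c<..<c'}"] integrable_indicator_diff)
      (auto simp: indicator_def)
  also have "\<dots> = (\<integral>x. indicator {..<c'} x * (x - e) - indicator {..<c} x * (x - e) \<partial>gauss \<sigma> \<mu>)"
    using assms(2) by (intro Bochner_Integration.integral_cong) (auto simp: indicator_def)
  also have "\<dots> = measure (gauss \<sigma> \<mu>) {..<c'} * (cond_mean \<sigma> \<mu> {..<c'} - e)"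
    using integrable_indicator_diff[OF assms(1), of "{..<c}" \<mu> e]
      integrable_indicator_diff[OF assms(1), of "{..<c'}" \<mu> e]
    by (simp add: integral_lessThan_diff[OF assms(1)] e_def)
  finally show ?thesis
    using measure_gauss_lessThan_pos[OF assms(1), of \<mu> c'] by (simp add: zero_less_mult_iff e_def)
qed

text \<open>After translating \<open>{..<c'}\<close> onto \<open>{..<c}\<close>, the density of \<open>c' - x\<close> is that of \<open>c - x\<close> times the
  decreasing factor \<open>\<rho>\<close>; comparing \<open>\<rho>\<close> with its value at the conditional mean \<open>e\<close> gives the
  pointwise bound \<open>(e - y) * (\<rho> y - \<rho> e) \<ge> 0\<close>.\<close>
lemma cond_mean_increment_le:
  assumes "0 < \<sigma>" "c \<le> c'"
  shows "cond_mean \<sigma> \<mu> {..<c'} - cond_mean \<sigma> \<mu> {..<c} \<le> c' - c"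
proof -
  define e where "e = cond_mean \<sigma> \<mu> {..<c}"
  define d where "d = c' - c"
  define \<rho> where "\<rho> y = exp (- (2 * (y - \<mu>) * d + d\<^sup>2) / (2 * \<sigma>\<^sup>2))" for y
  have d: "0 \<le> d" using assms(2) by (simp add: d_def)
  have rho: "normal_density (\<mu> - d) \<sigma> y = normal_density \<mu> \<sigma> y * \<rho> y" for y
  proof -
    have "- (y - (\<mu> - d))\<^sup>2 / (2 * \<sigma>\<^sup>2)
        = - (y - \<mu>)\<^sup>2 / (2 * \<sigma>\<^sup>2) + - (2 * (y - \<mu>) * d + d\<^sup>2) / (2 * \<sigma>\<^sup>2)"
      unfolding add_divide_distrib[symmetric] by (simp add: power2_eq_square algebra_simps)
    then show ?thesis by (simp only: normal_density_def \<rho>_def exp_add mult.assoc)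
  qed
  have antimono: "\<rho> y' \<le> \<rho> y" if "y \<le> y'" for y y'
  proof -
    have "(y - \<mu>) * d \<le> (y' - \<mu>) * d" using that d by (intro mult_right_mono) auto
    then have "- (2 * (y' - \<mu>) * d + d\<^sup>2) \<le> - (2 * (y - \<mu>) * d + d\<^sup>2)"
      by (simp only: mult.assoc)
    then show ?thesis
      unfolding \<rho>_def exp_le_cancel_iff by (rule divide_right_mono) simp
  qed
  have pointwise: "\<rho> e * (indicator {..<c} y * (y - e)) \<ge> \<rho> y * (indicator {..<c} y * (y - e))" for y
  proof -
    have "\<rho> y * (y - e) \<le> \<rho> e * (y - e)"
    proof (cases "y \<le> e")
      case True
      then show ?thesis using antimono[OF True] by (intro mult_right_mono_neg) auto
    next
      case False
      then show ?thesis using antimono[of e y] by (intro mult_right_mono) auto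
    qed
    then show ?thesis by (simp add: indicator_def)
  qed
  have [measurable]: "\<rho> \<in> borel_measurable borel" unfolding \<rho>_def by measurable
  let ?f = "\<lambda>y. indicator {..<c} y * (y - e)"
  have i: "integrable (gauss \<sigma> \<mu>) ?f" by (rule integrable_indicator_diff[OF assms(1)]) simp
  \<comment> \<open>\<open>\<rho>\<close> is unbounded when \<open>d > 0\<close>, so integrability
    is read off from the shifted Gaussian, whose density is the original one times
    \<open>\<rho>\<close>.\<close>
  have i\<rho>: "integrable (gauss \<sigma> \<mu>) (\<lambda>y. \<rho> y * ?f y)"
    using integrable_indicator_diff[OF assms(1), of "{..<c}" "\<mu> - d" e]
    by (simp add: integrable_gauss_iff rho mult.assoc)
  have "(\<integral>x. indicator {..<c'} x * (x - (e + d)) \<partial>gauss \<sigma> \<mu>)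
      = (\<integral>y. indicator {..<c'} (d + y) * ((d + y) - (e + d)) \<partial>gauss \<sigma> (- d + \<mu>))"
    by (subst integral_gauss_shift[where t = d and \<mu> = "- d + \<mu>", symmetric]) auto
  also have "\<dots> = (\<integral>y. ?f y \<partial>gauss \<sigma> (- d + \<mu>))"
    by (intro Bochner_Integration.integral_cong) (auto simp: indicator_def d_def)
  also have "\<dots> = (\<integral>y. \<rho> y * ?f y \<partial>gauss \<sigma> \<mu>)"
    by (simp add: integral_gauss rho mult.assoc)
  also have "\<dots> \<le> (\<integral>y. \<rho> e * ?f y \<partial>gauss \<sigma> \<mu>)"
    using i i\<rho> pointwise by (intro integral_mono) auto
  also have "\<dots> = 0"
    by (simp add: integral_lessThan_diff[OF assms(1)] e_def)
  finally have "measure (gauss \<sigma> \<mu>) {..<c'} * (cond_mean \<sigma> \<mu> {..<c'} - (e + d)) \<le> 0"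
    by (simp add: integral_lessThan_diff[OF assms(1)])
  then have "cond_mean \<sigma> \<mu> {..<c'} - (e + d) \<le> 0"
    using measure_gauss_lessThan_pos[OF assms(1), of \<mu> c'] by (simp add: mult_le_0_iff)
  then show ?thesis by (simp add: e_def d_def)
qed

lemma continuous_cond_mean:
  assumes "0 < \<sigma>"
  shows "continuous_on UNIV (\<lambda>c. cond_mean \<sigma> \<mu> {..<c})"
proof (rule lipschitz_on_continuous_on[where L = 1], rule lipschitz_onI)
  fix x y :: real
  show "dist (cond_mean \<sigma> \<mu> {..<x}) (cond_mean \<sigma> \<mu> {..<y}) \<le> 1 * dist x y"
  proof (cases x y rule: linorder_cases)
    case less
    then show ?thesis
      using strict_mono_cond_mean[OF assms less, of \<mu>] cond_mean_increment_le[OF assms, of x y \<mu>]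
      by (simp add: dist_real_def)
  next
    case greater
    then show ?thesis
      using strict_mono_cond_mean[OF assms greater, of \<mu>] cond_mean_increment_le[OF assms, of y x \<mu>]
      by (simp add: dist_real_def)
  qed simp
qed simp

section \<open>The equation for the steady-state cutoff\<close>

lemma ex_cutoff_equation:
  assumes "0 < \<sigma>" "0 < \<gamma>"
  obtains c where "\<gamma> * cond_mean \<sigma> \<mu> {..<c} - (1 + \<gamma>) * c = t"
proof -
  let ?e = "\<lambda>c. cond_mean \<sigma> \<mu> {..<c}"
  let ?f = "\<lambda>c. \<gamma> * ?e c - (1 + \<gamma>) * c"
  have cont: "continuous_on A ?f" for A
    using continuous_on_subset[OF continuous_cond_mean[OF assms(1), of \<mu>], of A]
    by (intro continuous_intros) auto
  \<comment> \<open>With \<open>?e c < c\<close> the function \<open>?f\<close> is at most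
    \<open>- c\<close>, which gives \<open>hi\<close>. Since \<open>c - ?e c\<close> is
    nondecreasing, for \<open>c \<le> 0\<close> its multiple by \<open>\<gamma>\<close> is at most
    its value \<open>b\<close> at 0, hence \<open>?f c \<ge> - c - b\<close>, which gives
    \<open>lo\<close>.\<close>
  define b where "b = \<gamma> * (0 - ?e 0)"
  define lo where "lo = min 0 (- (t + b))"
  define hi where "hi = max 0 (- t)"
  have "lo \<le> hi" by (simp add: lo_def hi_def)
  moreover have "?f hi \<le> t"
  proof -
    have "\<gamma> * ?e hi \<le> \<gamma> * hi"
      using cond_mean_less_bound[OF assms(1), of \<mu> hi] assms(2) by (intro mult_left_mono) auto
    moreover have "- hi \<le> t" by (simp add: hi_def)
    ultimately show ?thesis by (simp add: algebra_simps)
  qed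
  moreover have "t \<le> ?f lo"
  proof -
    have "\<gamma> * (lo - ?e lo) \<le> b"
      unfolding b_def using cond_mean_increment_le[OF assms(1), of lo 0 \<mu>] assms(2)
      by (intro mult_left_mono) (auto simp: lo_def)
    moreover have "t + b \<le> - lo" by (simp add: lo_def)
    ultimately show ?thesis by (simp add: algebra_simps)
  qed
  ultimately obtain c where "?f c = t"
    using IVT2'[of ?f hi t lo] cont by blast
  then show ?thesis by (rule that)
qed

text \<open>The conditional mean grows at most as fast as the cutoff, so the terms with factor
  \<open>\<gamma>\<close> together do not increase; the remaining \<open>- c\<close> makes the
  decrease strict.\<close>

lemma cutoff_equation_strict_antimono:
  assumes "0 < \<sigma>" "0 < \<gamma>" "c < c'"
  shows "\<gamma> * cond_mean \<sigma> \<mu> {..<c'} - (1 + \<gamma>) * c' < \<gamma> * cond_mean \<sigma> \<mu> {..<c} - (1 + \<gamma>) * c"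
proof -
  have "\<gamma> * (cond_mean \<sigma> \<mu> {..<c'} - cond_mean \<sigma> \<mu> {..<c}) \<le> \<gamma> * (c' - c)"
    using cond_mean_increment_le[OF assms(1), of c c' \<mu>] assms by (intro mult_left_mono) auto
  then show ?thesis using assms(3) by (simp add: algebra_simps)
qed

section \<open>Pseudo-true parameters\<close>

lemma option_space_generator:
  "insert {None} ((`) Some ` sets M) \<subseteq> Pow (insert None (Some ` space M))"
  using sets.sets_into_space[of _ M] by fastforce

lemma space_option_space [simp]: "space (option_space M) = insert None (Some ` space M)"
  unfolding option_space_def by (rule space_measure_of[OF option_space_generator])

lemma sets_option_space:
  "sets (option_space M) = sigma_sets (insert None (Some ` space M)) (insert {None} ((`) Some ` sets M))"
  unfolding option_space_def by (rule sets_measure_of[OF option_space_generator])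

lemma None_sets_option_space [measurable]: "{None} \<in> sets (option_space M)"
  unfolding sets_option_space by (rule sigma_sets.Basic) simp

lemma image_Some_sets_option_space: "A \<in> sets M \<Longrightarrow> Some ` A \<in> sets (option_space M)"
  unfolding sets_option_space by (rule sigma_sets.Basic) simp

text \<open>Extracts the second draw measurably. The default value 0 is masked in
  \<open>history_density\<close> by a case distinction on \<open>{None}\<close>.\<close>

lemma measurable_case_option_id [measurable]:
  "case_option (0 :: real) (\<lambda>y. y) \<in> option_space borel \<rightarrow>\<^sub>M borel"
proof (rule measurableI)
  fix A :: "real set" assume "A \<in> sets borel"
  then have "Some ` A \<union> (if 0 \<in> A then {None} else {}) \<in> sets (option_space borel)"
    by (intro sets.Un) (auto simp: image_Some_sets_option_space None_sets_option_space)
  also have "Some ` A \<union> (if 0 \<in> A then {None} else {})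
      = case_option 0 (\<lambda>y. y) -` A \<inter> space (option_space borel)"
    by (auto simp: image_iff split: option.splits if_splits)
  finally show "case_option 0 (\<lambda>y. y) -` A \<inter> space (option_space borel) \<in> sets (option_space borel)" .
qed simp

text \<open>The density of the law of the history with respect to the sum of Lebesgue measure on the
  stopped histories and Lebesgue measure on the continued ones; \<open>S\<close> only selects the support.\<close>
definition history_density :: "real \<Rightarrow> real \<Rightarrow> real \<Rightarrow> real \<Rightarrow> real \<times> real option \<Rightarrow> real" where
  "history_density \<sigma> \<mu>1 \<mu>2 \<gamma> = (\<lambda>(x, w). normal_density \<mu>1 \<sigma> x *
     (case w of None \<Rightarrow> 1 | Some y \<Rightarrow> normal_density (\<mu>2 - \<gamma> * (x - \<mu>1)) \<sigma> y))"

lemma history_density_pos: "0 < \<sigma> \<Longrightarrow> 0 < history_density \<sigma> \<mu>1 \<mu>2 \<gamma> h"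
  by (auto simp: history_density_def normal_density_pos split: prod.split option.split)

lemma measurable_history_density [measurable]:
  "history_density \<sigma> \<mu>1 \<mu>2 \<gamma> \<in> borel_measurable history_space"
proof -
  have "history_density \<sigma> \<mu>1 \<mu>2 \<gamma> = (\<lambda>h. normal_density \<mu>1 \<sigma> (fst h) *
     (if snd h \<in> {None} then 1
      else normal_density (\<mu>2 - \<gamma> * (fst h - \<mu>1)) \<sigma> (case_option 0 (\<lambda>y. y) (snd h))))"
    by (auto simp: history_density_def fun_eq_iff split: option.split)
  also have "\<dots> \<in> borel_measurable history_space"
    unfolding history_space_def normal_density_def by measurable
  finally show ?thesis .
qed

lemma measurable_history_Psi:
  assumes "S \<in> strategies"
  shows "history S \<in> Psi \<sigma> \<mu>1 \<mu>2 \<gamma> \<rightarrow>\<^sub>M history_space"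
  using measurable_history[OF assms] by (simp cong: measurable_cong_sets)

lemma sets_history_law [simp]: "sets (history_law P S) = sets history_space"
  by (simp add: history_law_def)

lemma prob_space_history_law:
  assumes "0 < \<sigma>" "S \<in> strategies"
  shows "prob_space (history_law (Psi \<sigma> \<mu>1 \<mu>2 \<gamma>) S)"
  unfolding history_law_def
  by (rule prob_space.prob_space_distr[OF prob_space_Psi[OF assms(1)] measurable_history_Psi[OF assms(2)]])

text \<open>Both laws are push-forwards under the same map, so Tonelli reduces the claim to a
  comparison for each first draw. The likelihood ratio thus serves as the Radon-Nikodym density in
  the divergence.\<close>

lemma history_law_eq_density:
  assumes "0 < \<sigma>" "S \<in> strategies"
  shows "history_law (Psi \<sigma> m1 m2 r) S = density (history_law (Psi \<sigma> \<mu>1 \<mu>2 \<gamma>) S)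
    (\<lambda>h. ennreal (history_density \<sigma> m1 m2 r h / history_density \<sigma> \<mu>1 \<mu>2 \<gamma> h))"
    (is "_ = density ?M ?f")
proof (rule measure_eqI)
  fix A assume "A \<in> sets (history_law (Psi \<sigma> m1 m2 r) S)"
  then have A [measurable]: "A \<in> sets history_space" by simp
  have T [measurable]: "history S \<in> borel \<Otimes>\<^sub>M borel \<rightarrow>\<^sub>M history_space"
    by (rule measurable_history[OF assms(2)])
  note TP = measurable_history_Psi[OF assms(2)]
  have f [measurable]: "?f \<in> borel_measurable history_space" by measurable
  have one: "(\<integral>\<^sup>+y. ennreal (normal_density m \<sigma> y) * c \<partial>lborel) = c" for m c
    using assms(1) by (simp add: nn_integral_multc nn_integral_eq_integral)
  have inner: "ennreal (normal_density m1 \<sigma> x) *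
      (\<integral>\<^sup>+y. ennreal (normal_density (m2 - r * (x - m1)) \<sigma> y) * indicator A (history S (x, y)) \<partial>lborel)
    = ennreal (normal_density \<mu>1 \<sigma> x) *
      (\<integral>\<^sup>+y. ennreal (normal_density (\<mu>2 - \<gamma> * (x - \<mu>1)) \<sigma> y)
        * (?f (history S (x, y)) * indicator A (history S (x, y))) \<partial>lborel)" (is "?l = ?r") for x
  proof (cases "S x")
    \<comment> \<open>The second draw is unobserved, so its densities integrate to one on both sides
      and only the ratio for the first draw remains.\<close>
    case Stop
    have "?l = ennreal (normal_density m1 \<sigma> x) * indicator A (x, None)"
      using Stop by (simp add: history_def one)
    also have "\<dots> = ennreal (normal_density \<mu>1 \<sigma> x) *
        (ennreal (normal_density m1 \<sigma> x / normal_density \<mu>1 \<sigma> x) * indicator A (x, None))"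
      using normal_density_pos[OF assms(1)]
      by (simp add: mult.assoc[symmetric] ennreal_mult[symmetric] less_imp_neq[symmetric])
    also have "\<dots> = ?r"
      using Stop by (simp add: history_def history_density_def one)
    finally show ?thesis .
  next
    case Continue
    have "ennreal (normal_density m1 \<sigma> x) *
        (ennreal (normal_density (m2 - r * (x - m1)) \<sigma> y) * indicator A (x, Some y))
      = ennreal (normal_density \<mu>1 \<sigma> x) * (ennreal (normal_density (\<mu>2 - \<gamma> * (x - \<mu>1)) \<sigma> y)
        * (?f (x, Some y) * indicator A (x, Some y)))" for y
      using normal_density_pos[OF assms(1), of \<mu>1 x]
        normal_density_pos[OF assms(1), of "\<mu>2 - \<gamma> * (x - \<mu>1)" y]
      by (simp add: mult.assoc[symmetric] ennreal_mult[symmetric] history_density_def)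
    then have "(\<integral>\<^sup>+y. ennreal (normal_density m1 \<sigma> x) *
        (ennreal (normal_density (m2 - r * (x - m1)) \<sigma> y) * indicator A (history S (x, y))) \<partial>lborel)
      = (\<integral>\<^sup>+y. ennreal (normal_density \<mu>1 \<sigma> x) * (ennreal (normal_density (\<mu>2 - \<gamma> * (x - \<mu>1)) \<sigma> y)
        * (?f (history S (x, y)) * indicator A (history S (x, y)))) \<partial>lborel)"
      using Continue by (simp add: history_def)
    moreover have "(\<integral>\<^sup>+y. ennreal (normal_density m1 \<sigma> x) *
        (ennreal (normal_density (m2 - r * (x - m1)) \<sigma> y) * indicator A (history S (x, y))) \<partial>lborel) = ?l"
      by (rule nn_integral_cmult) measurable
    moreover have "(\<integral>\<^sup>+y. ennreal (normal_density \<mu>1 \<sigma> x) * (ennreal (normal_density (\<mu>2 - \<gamma> * (x - \<mu>1)) \<sigma> y)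
        * (?f (history S (x, y)) * indicator A (history S (x, y)))) \<partial>lborel) = ?r"
      by (rule nn_integral_cmult) measurable
    ultimately show ?thesis by (simp only:)
  qed
  have "emeasure (history_law (Psi \<sigma> m1 m2 r) S) A = (\<integral>\<^sup>+h. indicator A h \<partial>history_law (Psi \<sigma> m1 m2 r) S)"
    by simp
  also have "\<dots> = (\<integral>\<^sup>+z. indicator A (history S z) \<partial>Psi \<sigma> m1 m2 r)"
    unfolding history_law_def by (rule nn_integral_distr[OF TP]) simp
  also have "\<dots> = (\<integral>\<^sup>+z. ?f (history S z) * indicator A (history S z) \<partial>Psi \<sigma> \<mu>1 \<mu>2 \<gamma>)"
    by (subst (1 2) nn_integral_Psi, measurable) (simp only: inner)
  also have "\<dots> = (\<integral>\<^sup>+h. ?f h * indicator A h \<partial>?M)"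
    unfolding history_law_def by (rule nn_integral_distr[OF TP, symmetric]) simp
  also have "\<dots> = emeasure (density ?M ?f) A"
    using f A by (subst emeasure_density) (simp_all cong: measurable_cong_sets)
  finally show "emeasure (history_law (Psi \<sigma> m1 m2 r) S) A = emeasure (density ?M ?f) A" .
qed simp

section \<open>The divergence as a quadratic form\<close>

lemma ln_normal_density_ratio:
  assumes "0 < \<sigma>"
  shows "ln (normal_density m \<sigma> x / normal_density \<mu> \<sigma> x) = ((x - \<mu>)\<^sup>2 - (x - m)\<^sup>2) / (2 * \<sigma>\<^sup>2)"
proof -
  have "normal_density m \<sigma> x / normal_density \<mu> \<sigma> x = exp (- (x - m)\<^sup>2 / (2 * \<sigma>\<^sup>2) - - (x - \<mu>)\<^sup>2 / (2 * \<sigma>\<^sup>2))"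
    unfolding exp_diff using assms by (simp add: normal_density_def)
  then show ?thesis by (simp add: diff_divide_distrib)
qed

text \<open>Cauchy-Schwarz for \<open>(\<alpha>, \<beta>, \<delta>)\<close> and
  \<open>(1, x, y)\<close>, proved by the Lagrange identity.\<close>

lemma power2_affine_le:
  fixes x y :: real
  shows "(\<alpha> + \<beta> * x + \<delta> * y)\<^sup>2 \<le> (\<alpha>\<^sup>2 + \<beta>\<^sup>2 + \<delta>\<^sup>2) * (1 + x\<^sup>2 + y\<^sup>2)"
proof -
  have "(\<alpha>\<^sup>2 + \<beta>\<^sup>2 + \<delta>\<^sup>2) * (1 + x\<^sup>2 + y\<^sup>2) - (\<alpha> + \<beta> * x + \<delta> * y)\<^sup>2
      = (\<alpha> * x - \<beta>)\<^sup>2 + (\<alpha> * y - \<delta>)\<^sup>2 + (\<beta> * y - \<delta> * x)\<^sup>2"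
    by (simp add: power2_eq_square algebra_simps)
  moreover have "0 \<le> (\<alpha> * x - \<beta>)\<^sup>2 + (\<alpha> * y - \<delta>)\<^sup>2 + (\<beta> * y - \<delta> * x)\<^sup>2" by simp
  ultimately show ?thesis by linarith
qed

text \<open>Up to the factor \<open>1 / (2 * \<sigma>\<^sup>2)\<close> this is the divergence
  between two Gaussians of equal variance. The squares of \<open>y\<close> cancel, so only the first
  moment enters.\<close>

lemma integral_gauss_power2_diff:
  assumes "0 < \<sigma>"
  shows "(\<integral>y. (y - \<mu>)\<^sup>2 - (y - m)\<^sup>2 \<partial>gauss \<sigma> m) = (m - \<mu>)\<^sup>2"
proof -
  have "(\<lambda>y. (y - \<mu>)\<^sup>2 - (y - m)\<^sup>2) = (\<lambda>y. (2 * (m - \<mu>)) * y + (\<mu>\<^sup>2 - m\<^sup>2))"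
    by (auto simp: power2_eq_square algebra_simps)
  then have "(\<integral>y. (y - \<mu>)\<^sup>2 - (y - m)\<^sup>2 \<partial>gauss \<sigma> m) = (2 * (m - \<mu>)) * m + (\<mu>\<^sup>2 - m\<^sup>2)"
    using assms by (simp only:) simp
  then show ?thesis by (simp add: power2_eq_square algebra_simps)
qed

text \<open>This is the chain rule for relative entropy: the first draw is always observed, while
  the gap between the conditional means of the second counts only where the strategy
  continues.\<close>

lemma history_KL_eq:
  assumes "0 < \<sigma>" "S \<in> strategies"
  shows "history_KL \<sigma> m1 m2 r S (\<mu>1, \<mu>2, \<gamma>) = ((m1 - \<mu>1)\<^sup>2 +
    (\<integral>x. indicator {x. S x = Continue} x *
       ((m2 - r * (x - m1)) - (\<mu>2 - \<gamma> * (x - \<mu>1)))\<^sup>2 \<partial>gauss \<sigma> m1)) / (2 * \<sigma>\<^sup>2)"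
proof -
  let ?M = "history_law (Psi \<sigma> \<mu>1 \<mu>2 \<gamma>) S" and ?N = "history_law (Psi \<sigma> m1 m2 r) S"
  define f where "f h = history_density \<sigma> m1 m2 r h / history_density \<sigma> \<mu>1 \<mu>2 \<gamma> h" for h
  define C where "C = {x. S x = Continue}"
  have C [measurable]: "C \<in> sets borel" unfolding C_def by (rule sets_Continue[OF assms(2)])
  interpret M: prob_space ?M by (rule prob_space_history_law[OF assms])
  have f_pos: "0 < f h" for h
    using history_density_pos[OF assms(1)] by (simp add: f_def)
  have f_meas [measurable]: "f \<in> borel_measurable history_space"
    unfolding f_def by measurable
  then have f_M: "f \<in> borel_measurable ?M" by (simp cong: measurable_cong_sets)
  have N: "?N = density ?M (\<lambda>h. ennreal (f h))"
    unfolding f_def by (rule history_law_eq_density[OF assms])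
  define v where "v = 2 * \<sigma>\<^sup>2"
  have v: "0 < v" using assms(1) by (simp add: v_def)
  define m where "m x = m2 - r * (x - m1)" for x
  define \<mu> where "\<mu> x = \<mu>2 - \<gamma> * (x - \<mu>1)" for x
  \<comment> \<open>The log-likelihood ratio pulled back along \<open>history S\<close> to the
    underlying draws, so that it can be integrated under the joint law.\<close>
  define L where "L = (\<lambda>(x, y). ((x - \<mu>1)\<^sup>2 - (x - m1)\<^sup>2) / v
    + indicator C x * (((y - \<mu> x)\<^sup>2 - (y - m x)\<^sup>2) / v))"
  have L_meas: "L \<in> borel_measurable (borel \<Otimes>\<^sub>M borel)"
    unfolding L_def m_def \<mu>_def by measurable
  have ln_f: "ln (f (history S z)) = L z" for z
  proof -
    obtain x y where z: "z = (x, y)" by force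
    have ratio_pos: "0 < normal_density a \<sigma> t / normal_density b \<sigma> t" for a b t
      by (simp add: normal_density_pos[OF assms(1)])
    have "f (history S z) = normal_density m1 \<sigma> x / normal_density \<mu>1 \<sigma> x *
        (if x \<in> C then normal_density (m x) \<sigma> y / normal_density (\<mu> x) \<sigma> y else 1)"
      by (cases "S x") (auto simp: z f_def history_def history_density_def C_def m_def \<mu>_def)
    then show ?thesis
      by (cases "x \<in> C")
        (simp_all add: ln_mult_pos[OF ratio_pos ratio_pos] ln_normal_density_ratio[OF assms(1)] L_def z v_def
          del: times_divide_eq_left times_divide_eq_right)
  qed
  have L_bound: "\<exists>B. \<forall>x y. \<bar>L (x, y)\<bar> \<le> B * (1 + x\<^sup>2 + y\<^sup>2)"
  proof -
    \<comment> \<open>\<open>L\<close> is a combination of four squares of affine functions; each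
      \<open>Q\<close> is the Cauchy-Schwarz constant of one of them.\<close>
    define Q :: "real \<Rightarrow> real \<Rightarrow> real \<Rightarrow> real" where "Q \<alpha> \<beta> \<delta> = (\<alpha>\<^sup>2 + \<beta>\<^sup>2 + \<delta>\<^sup>2)" for \<alpha> \<beta> \<delta>
    define B where "B = (Q (- \<mu>1) 1 0 + Q (- m1) 1 0 + Q (- (\<mu>2 + \<gamma> * \<mu>1)) \<gamma> 1 + Q (- (m2 + r * m1)) r 1) / v"
    have "\<bar>L (x, y)\<bar> \<le> B * (1 + x\<^sup>2 + y\<^sup>2)" for x y
    proof -
      have s: "(x - \<mu>1)\<^sup>2 \<le> Q (- \<mu>1) 1 0 * (1 + x\<^sup>2 + y\<^sup>2)"
        "(x - m1)\<^sup>2 \<le> Q (- m1) 1 0 * (1 + x\<^sup>2 + y\<^sup>2)"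
        "(y - \<mu> x)\<^sup>2 \<le> Q (- (\<mu>2 + \<gamma> * \<mu>1)) \<gamma> 1 * (1 + x\<^sup>2 + y\<^sup>2)"
        "(y - m x)\<^sup>2 \<le> Q (- (m2 + r * m1)) r 1 * (1 + x\<^sup>2 + y\<^sup>2)"
        using power2_affine_le[of "- \<mu>1" 1 x 0 y] power2_affine_le[of "- m1" 1 x 0 y]
          power2_affine_le[of "- (\<mu>2 + \<gamma> * \<mu>1)" \<gamma> x 1 y] power2_affine_le[of "- (m2 + r * m1)" r x 1 y]
        by (simp_all add: Q_def \<mu>_def m_def algebra_simps)
      have "L (x, y) = (((x - \<mu>1)\<^sup>2 - (x - m1)\<^sup>2) + indicator C x * ((y - \<mu> x)\<^sup>2 - (y - m x)\<^sup>2)) / v"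
        by (simp add: L_def add_divide_distrib)
      moreover have "\<bar>((x - \<mu>1)\<^sup>2 - (x - m1)\<^sup>2) + indicator C x * ((y - \<mu> x)\<^sup>2 - (y - m x)\<^sup>2)\<bar>
          \<le> (x - \<mu>1)\<^sup>2 + (x - m1)\<^sup>2 + (y - \<mu> x)\<^sup>2 + (y - m x)\<^sup>2"
        using zero_le_power2[of "x - \<mu>1"] zero_le_power2[of "x - m1"]
          zero_le_power2[of "y - \<mu> x"] zero_le_power2[of "y - m x"]
        by (auto simp: indicator_def abs_le_iff)
      moreover have "\<dots> \<le> (B * v) * (1 + x\<^sup>2 + y\<^sup>2)"
      proof -
        have "B * v = Q (- \<mu>1) 1 0 + Q (- m1) 1 0 + Q (- (\<mu>2 + \<gamma> * \<mu>1)) \<gamma> 1 + Q (- (m2 + r * m1)) r 1"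
          using v by (simp add: B_def)
        then show ?thesis using s by (simp only: distrib_right add_mono)
      qed
      ultimately show ?thesis
        using v by (simp add: abs_divide divide_le_eq mult_ac)
    qed
    then show ?thesis by blast
  qed
  then obtain B where B: "\<And>x y. \<bar>L (x, y)\<bar> \<le> B * (1 + x\<^sup>2 + y\<^sup>2)" by blast
  have inner: "(\<integral>y. L (x, y) \<partial>gauss \<sigma> (m x))
      = ((x - \<mu>1)\<^sup>2 - (x - m1)\<^sup>2) / v + indicator C x * (m x - \<mu> x)\<^sup>2 / v" for x
  proof -
    have i: "integrable (gauss \<sigma> (m x)) (\<lambda>y. (y - \<mu> x)\<^sup>2 - (y - m x)\<^sup>2)"
    proof -
      have "(\<lambda>y. (y - \<mu> x)\<^sup>2 - (y - m x)\<^sup>2) = (\<lambda>y. (2 * (m x - \<mu> x)) * y + ((\<mu> x)\<^sup>2 - (m x)\<^sup>2))"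
        by (auto simp: power2_eq_square algebra_simps)
      then show ?thesis using assms(1) by simp
    qed
    show ?thesis
      using assms(1) i integral_gauss_power2_diff[OF assms(1), where \<mu> = "\<mu> x" and m = "m x"] by (simp add: L_def)
  qed
  have "history_KL \<sigma> m1 m2 r S (\<mu>1, \<mu>2, \<gamma>) = KL_divergence (exp 1) ?M (density ?M (\<lambda>h. ennreal (f h)))"
    by (simp add: history_KL_def N)
  also have "\<dots> = (\<integral>h. f h * log (exp 1) (f h) \<partial>?M)"
    using f_pos by (intro M.KL_density f_M AE_I2) (auto intro: less_imp_le)
  \<comment> \<open>The factor \<open>f h\<close> is absorbed by changing from the model law to the
    true law.\<close>
  also have "\<dots> = (\<integral>h. ln (f h) \<partial>?N)"
    unfolding N using f_pos f_M
    by (subst integral_density) (auto intro!: AE_I2 intro: less_imp_le simp: log_def)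
  also have "\<dots> = (\<integral>z. L z \<partial>Psi \<sigma> m1 m2 r)"
    unfolding history_law_def
    by (subst integral_distr[OF measurable_history_Psi[OF assms(2)]]) (auto simp: ln_f)
  also have "\<dots> = (\<integral>x. (\<integral>y. L (x, y) \<partial>gauss \<sigma> (m x)) \<partial>gauss \<sigma> m1)"
    unfolding m_def by (rule integral_Psi_bound[OF assms(1) L_meas B])
  also have "\<dots> = (\<integral>x. ((x - \<mu>1)\<^sup>2 - (x - m1)\<^sup>2) / v + indicator C x * (m x - \<mu> x)\<^sup>2 / v \<partial>gauss \<sigma> m1)"
    by (simp only: inner)
  also have "\<dots> = ((m1 - \<mu>1)\<^sup>2 + (\<integral>x. indicator C x * (m x - \<mu> x)\<^sup>2 \<partial>gauss \<sigma> m1)) / v"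
  proof -
    have "(\<lambda>x. (x - \<mu>1)\<^sup>2 - (x - m1)\<^sup>2) = (\<lambda>x. (2 * (m1 - \<mu>1)) * x + (\<mu>1\<^sup>2 - m1\<^sup>2))"
      by (auto simp: power2_eq_square algebra_simps)
    then have "integrable (gauss \<sigma> m1) (\<lambda>x. (x - \<mu>1)\<^sup>2 - (x - m1)\<^sup>2)"
      using assms(1) by simp
    moreover have "integrable (gauss \<sigma> m1) (\<lambda>x. indicator C x * (m x - \<mu> x)\<^sup>2)"
    proof -
      define \<alpha> \<beta> where "\<alpha> = m2 + r * m1 - \<mu>2 - \<gamma> * \<mu>1" and "\<beta> = \<gamma> - r"
      have eq: "m x - \<mu> x = \<alpha> + \<beta> * x" for x
        by (simp add: m_def \<mu>_def \<alpha>_def \<beta>_def algebra_simps)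
      have "\<bar>indicator C x * (\<alpha> + \<beta> * x)\<^sup>2\<bar> \<le> (\<alpha>\<^sup>2 + \<beta>\<^sup>2) + (\<alpha>\<^sup>2 + \<beta>\<^sup>2) * x\<^sup>2" for x
        using power2_affine_le[of \<alpha> \<beta> x 0 0] by (auto simp: indicator_def distrib_left)
      then show ?thesis
        unfolding eq by (intro integrable_gauss_bound[OF assms(1)]) auto
    qed
    ultimately show ?thesis
      by (simp add: integral_gauss_power2_diff[OF assms(1)] add_divide_distrib)
  qed
  finally show ?thesis by (simp add: C_def m_def \<mu>_def v_def)
qed

text \<open>Centering at the conditional mean \<open>e\<close> splits the divergence into
  \<open>(m1 - \<mu>1)\<^sup>2\<close>, a multiple of a squared mean error, and
  \<open>(\<gamma> - r)\<^sup>2 * V\<close>. The first two vanish for a unique choice of means given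
  \<open>\<gamma>\<close>, so the last one selects the point \<open>g\<close> nearest to
  \<open>r\<close>.\<close>

lemma pseudo_true_eq:
  assumes "0 < \<sigma>" "S \<in> strategies" "continues_with_pos_prob S"
    and g: "g \<in> {\<gamma>l..\<gamma>h}" "\<And>\<gamma>. \<gamma> \<in> {\<gamma>l..\<gamma>h} \<Longrightarrow> \<gamma> \<noteq> g \<Longrightarrow> \<bar>g - r\<bar> < \<bar>\<gamma> - r\<bar>"
  shows "pseudo_true \<sigma> m1 m2 r \<gamma>l \<gamma>h S
    = (m1, m2 + (g - r) * (cond_mean \<sigma> m1 {x. S x = Continue} - m1), g)"
proof -
  define C where "C = {x. S x = Continue}"
  define e where "e = cond_mean \<sigma> m1 C"
  define p where "p = measure (gauss \<sigma> m1) C"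
  define V where "V = (\<integral>x. indicator C x * (x - e)\<^sup>2 \<partial>gauss \<sigma> m1)"
  have C: "C \<in> sets borel" unfolding C_def by (rule sets_Continue[OF assms(2)])
  have C_pos: "0 < emeasure lborel C"
    using assms(3) by (simp add: continues_with_pos_prob_def C_def vimage_def)
  have p: "0 < p" unfolding p_def by (rule measure_gauss_pos[OF assms(1) C C_pos])
  have V_int: "integrable (gauss \<sigma> m1) (\<lambda>x. indicator C x * (x - e)\<^sup>2)"
  proof (rule integrable_gauss_bound[OF assms(1)])
    show "(\<lambda>x. indicator C x * (x - e)\<^sup>2) \<in> borel_measurable borel" using C by measurable
    show "\<bar>indicator C x * (x - e)\<^sup>2\<bar> \<le> (e\<^sup>2 + 1) + (e\<^sup>2 + 1) * x\<^sup>2" for x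
      using power2_affine_le[of "- e" 1 x 0 0] by (auto simp: indicator_def distrib_left)
  qed
  \<comment> \<open>A single point is null, so the first draw still varies on the continuation
    region. This positive variance is what identifies \<open>\<gamma>\<close>.\<close>
  have V: "0 < V"
    unfolding V_def
  proof (rule integral_gauss_pos[OF assms(1) V_int])
    show "C - {e} \<in> sets borel" using C by simp
    have "emeasure lborel (C - {e}) = emeasure lborel C"
      using C by (intro emeasure_Diff_null_set) auto
    then show "0 < emeasure lborel (C - {e})" using C_pos by simp
  qed auto
  have KL: "history_KL \<sigma> m1 m2 r S (\<mu>1, \<mu>2, \<gamma>) = ((m1 - \<mu>1)\<^sup>2 +
     (p * (m2 + r * m1 - \<mu>2 - \<gamma> * \<mu>1 + (\<gamma> - r) * e)\<^sup>2 + (\<gamma> - r)\<^sup>2 * V)) / (2 * \<sigma>\<^sup>2)" for \<mu>1 \<mu>2 \<gamma>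
  proof -
    define a where "a = m2 + r * m1 - \<mu>2 - \<gamma> * \<mu>1 + (\<gamma> - r) * e"
    define b where "b = \<gamma> - r"
    \<comment> \<open>The gap between the conditional means equals \<open>a + b * (x - e)\<close>;
      the cross term integrates to zero because \<open>e\<close> is the conditional mean.\<close>
    have "(\<integral>x. indicator C x * ((m2 - r * (x - m1)) - (\<mu>2 - \<gamma> * (x - \<mu>1)))\<^sup>2 \<partial>gauss \<sigma> m1)
      = (\<integral>x. indicator C x * a\<^sup>2 + (2 * a * b) * (indicator C x * (x - e))
          + b\<^sup>2 * (indicator C x * (x - e)\<^sup>2) \<partial>gauss \<sigma> m1)"
      by (intro Bochner_Integration.integral_cong)
        (auto simp: indicator_def a_def b_def power2_eq_square algebra_simps)
    also have "\<dots> = p * a\<^sup>2 + (2 * a * b) * (p * (e - e)) + b\<^sup>2 * V"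
    proof -
      have "integrable (gauss \<sigma> m1) (\<lambda>x. indicator C x * a\<^sup>2)"
        using C by (intro integrable_gauss_bound[OF assms(1), where a = "a\<^sup>2" and b = 0])
          (auto simp: indicator_def)
      then show ?thesis
        using V_int integrable_indicator_diff[OF assms(1) C, of m1 e]
          integral_indicator_diff_cond_mean[OF assms(1) C C_pos, of m1 e]
        by (simp add: V_def p_def e_def)
    qed
    finally show ?thesis
      unfolding history_KL_eq[OF assms(1,2)] C_def[symmetric] by (simp add: a_def b_def)
  qed
  define F where "F = history_KL \<sigma> m1 m2 r S"
  \<comment> \<open>The second component solves \<open>a = 0\<close> for \<open>\<mu>2\<close> with
    \<open>\<mu>1 = m1\<close> and \<open>\<gamma> = g\<close>.\<close>
  define t where "t = (m1, m2 + (g - r) * (e - m1), g)"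
  have F_t: "F t = (g - r)\<^sup>2 * V / (2 * \<sigma>\<^sup>2)"
    unfolding F_def t_def KL by (simp add: algebra_simps)
  have less: "F t < F z" if "z \<in> UNIV \<times> UNIV \<times> {\<gamma>l..\<gamma>h}" "z \<noteq> t" for z
  proof -
    obtain \<mu>1 \<mu>2 \<gamma> where z: "z = (\<mu>1, \<mu>2, \<gamma>)" by (cases z)
    define a where "a = m2 + r * m1 - \<mu>2 - \<gamma> * \<mu>1 + (\<gamma> - r) * e"
    have \<gamma>: "\<gamma> \<in> {\<gamma>l..\<gamma>h}" using that(1) z by simp
    have sq: "0 \<le> (m1 - \<mu>1)\<^sup>2" "0 \<le> p * a\<^sup>2" using p by auto
    have "(g - r)\<^sup>2 * V < (m1 - \<mu>1)\<^sup>2 + (p * a\<^sup>2 + (\<gamma> - r)\<^sup>2 * V)"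
    proof (cases "\<gamma> = g")
      case False
      then have "(g - r)\<^sup>2 < (\<gamma> - r)\<^sup>2" using power_strict_mono[OF g(2)[OF \<gamma>], of 2] by simp
      then have "(g - r)\<^sup>2 * V < (\<gamma> - r)\<^sup>2 * V" using V by simp
      then show ?thesis using sq by linarith
    next
      case True
      then have "m1 \<noteq> \<mu>1 \<or> a \<noteq> 0"
        using that(2) by (auto simp: z t_def a_def algebra_simps)
      then have "0 < (m1 - \<mu>1)\<^sup>2 \<or> 0 < p * a\<^sup>2" using p by auto
      then show ?thesis using sq True by (auto intro: add_pos_nonneg add_nonneg_pos)
    qed
    then show ?thesis
      unfolding F_t unfolding F_def z KL using assms(1) by (intro divide_strict_right_mono) (auto simp: a_def)
  qed
  have t_in: "t \<in> UNIV \<times> UNIV \<times> {\<gamma>l..\<gamma>h}" using g(1) by (simp add: t_def)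
  have "arg_min F (\<lambda>z. z \<in> UNIV \<times> UNIV \<times> {\<gamma>l..\<gamma>h}) = t"
  proof (rule arg_minI[where x = t])
    show "t \<in> UNIV \<times> UNIV \<times> {\<gamma>l..\<gamma>h}" by (rule t_in)
    show "\<not> F y < F t" if "y \<in> UNIV \<times> UNIV \<times> {\<gamma>l..\<gamma>h}" for y
      using less[OF that] by (cases "y = t") auto
    show "x = t" if "x \<in> UNIV \<times> UNIV \<times> {\<gamma>l..\<gamma>h}"
      "\<forall>y. y \<in> UNIV \<times> UNIV \<times> {\<gamma>l..\<gamma>h} \<longrightarrow> \<not> F y < F x" for x
      using less[OF that(1)] that(2) t_in by blast
  qed
  then show ?thesis
    unfolding pseudo_true_def arg_min_on_def F_def t_def e_def C_def .
qed

section \<open>Steady states\<close>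

lemma AE_in_Continue_iff:
  assumes "has_cutoff S c"
  shows "AE x in lborel. x \<in> {x. S x = Continue} \<longleftrightarrow> x \<in> {..<c}"
  using assms unfolding has_cutoff_def
proof eventually_elim
  case (elim x)
  then show ?case by (cases "S x") auto
qed

text \<open>Conditional means ignore null sets, so any representative of a cutoff strategy induces
  the same inference.\<close>

lemma cond_mean_cutoff:
  assumes "0 < \<sigma>" "S \<in> strategies" "has_cutoff S c"
  shows "cond_mean \<sigma> \<mu> {x. S x = Continue} = cond_mean \<sigma> \<mu> {..<c}"
proof -
  have [measurable]: "{x. S x = Continue} \<in> sets borel" by (rule sets_Continue[OF assms(2)])
  have AE: "AE x in gauss \<sigma> \<mu>. x \<in> {x. S x = Continue} \<longleftrightarrow> x \<in> {..<c}"
    using AE_in_Continue_iff[OF assms(3)] AE_gauss_iff[OF assms(1)] by simp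
  have "measure (gauss \<sigma> \<mu>) {x. S x = Continue} = measure (gauss \<sigma> \<mu>) {..<c}"
    by (rule measure_eq_AE[OF AE]) measurable
  moreover have "(\<integral>x. indicator {x. S x = Continue} x * x \<partial>gauss \<sigma> \<mu>) = (\<integral>x. indicator {..<c} x * x \<partial>gauss \<sigma> \<mu>)"
  proof (rule integral_cong_AE)
    show "AE x in gauss \<sigma> \<mu>. indicator {x. S x = Continue} x * x = indicator {..<c} x * x"
      using AE by eventually_elim (simp add: indicator_def)
  qed measurable
  ultimately show ?thesis by (simp add: cond_mean_def)
qed

lemma continues_with_pos_prob_cutoff_strategy: "continues_with_pos_prob (cutoff_strategy c)"
proof -
  have "cutoff_strategy c -` {Continue} = {..<c}"
    by (auto simp: cutoff_strategy_def split: if_splits)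
  then show ?thesis
    using emeasure_lborel_lessThan_pos[of c] by (simp add: continues_with_pos_prob_def)
qed

text \<open>If \<open>\<gamma>l \<le> 0\<close>, the point of the interval nearest to 0 is
  \<open>min 0 \<gamma>h\<close>, which is not positive. Hence the interval lies to the right of 0
  and \<open>\<gamma>l\<close> is its nearest point.\<close>

lemma gamma_near_0_pos:
  assumes "\<gamma>l \<le> \<gamma>h" "0 < gamma_near 0 \<gamma>l \<gamma>h"
  shows "0 < \<gamma>l"
proof (rule ccontr)
  assume "\<not> 0 < \<gamma>l"
  then have k: "min 0 \<gamma>h \<in> {\<gamma>l..\<gamma>h}" using assms(1) by auto
  have "arg_min (\<lambda>\<gamma>. \<bar>\<gamma> - 0\<bar>) (\<lambda>\<gamma>. \<gamma> \<in> {\<gamma>l..\<gamma>h}) \<le> 0"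
  proof (rule arg_minI[where x = "min 0 \<gamma>h"])
    show "min 0 \<gamma>h \<in> {\<gamma>l..\<gamma>h}" by (rule k)
    show "\<not> \<bar>y - 0\<bar> < \<bar>min 0 \<gamma>h - 0\<bar>" if "y \<in> {\<gamma>l..\<gamma>h}" for y
      using that by auto
    show "x \<le> 0" if "x \<in> {\<gamma>l..\<gamma>h}" "\<forall>y. y \<in> {\<gamma>l..\<gamma>h} \<longrightarrow> \<not> \<bar>y - 0\<bar> < \<bar>x - 0\<bar>" for x
      using that(1) that(2)[rule_format, OF k] by (auto simp: min_def split: if_splits)
  qed
  then show False using assms(2) by (simp add: gamma_near_def arg_min_on_def)
qed

text \<open>The definite description needs existence and uniqueness. The cutoff strategy at
  \<open>c\<close> is a witness; conversely, inference fixes the beliefs given the cutoff,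
  optimality turns the cutoff into a solution of the same equation, and strict monotonicity leaves
  only \<open>c\<close>.\<close>

lemma the_steady_state_eq:
  assumes "0 < \<sigma>" "0 < \<gamma>l" "\<gamma>l \<le> \<gamma>h" "0 \<le> q" "q < 1"
    and c: "gain \<sigma> q (m2 + (\<gamma>l * cond_mean \<sigma> m1 {..<c} - (1 + \<gamma>l) * c)) = \<kappa>"
  shows "the_steady_state \<sigma> m1 m2 0 \<gamma>l \<gamma>h q \<kappa> = ((m1, m2 + \<gamma>l * (cond_mean \<sigma> m1 {..<c} - m1), \<gamma>l), c)"
proof -
  have pseudo: "pseudo_true \<sigma> m1 m2 0 \<gamma>l \<gamma>h S = (m1, m2 + \<gamma>l * (cond_mean \<sigma> m1 {..<b} - m1), \<gamma>l)"
    if "S \<in> strategies" "continues_with_pos_prob S" "has_cutoff S b" for S b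
    using pseudo_true_eq[OF assms(1) that(1,2), of \<gamma>l \<gamma>l \<gamma>h 0 m1 m2] assms(2,3)
    by (simp add: cond_mean_cutoff[OF assms(1) that(1,3)])
  let ?e = "cond_mean \<sigma> m1 {..<c}"
  let ?P = "\<lambda>((\<mu>1, \<mu>2, \<gamma>), c). \<exists>S. steady_state \<sigma> m1 m2 0 \<gamma>l \<gamma>h q \<kappa> \<mu>1 \<mu>2 \<gamma> S \<and> has_cutoff S c"
  \<comment> \<open>Once the inferred beliefs are inserted, \<open>m1\<close> cancels and the
    indifference condition becomes the cutoff equation.\<close>
  have arg: "m2 + \<gamma>l * (cond_mean \<sigma> m1 {..<b} - m1) + \<gamma>l * m1 - (1 + \<gamma>l) * b
      = m2 + (\<gamma>l * cond_mean \<sigma> m1 {..<b} - (1 + \<gamma>l) * b)" for b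
    by (simp add: algebra_simps)
  have "optimal_strategy q \<kappa> (Psi \<sigma> m1 (m2 + \<gamma>l * (?e - m1)) \<gamma>l) (cutoff_strategy c)"
    using optimal_strategy_iff[OF assms(1,4,5), of \<gamma>l "m2 + \<gamma>l * (?e - m1)" m1 c \<kappa> "cutoff_strategy c"]
      assms(2) c cutoff_strategy_in_strategies[of c] has_cutoff_cutoff_strategy[of c]
    unfolding arg by simp
  then have "steady_state \<sigma> m1 m2 0 \<gamma>l \<gamma>h q \<kappa> m1 (m2 + \<gamma>l * (?e - m1)) \<gamma>l (cutoff_strategy c)"
    using assms(3) pseudo[OF cutoff_strategy_in_strategies continues_with_pos_prob_cutoff_strategy
        has_cutoff_cutoff_strategy, of c]
    by (simp add: steady_state_def continues_with_pos_prob_cutoff_strategy)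
  then have "?P ((m1, m2 + \<gamma>l * (?e - m1), \<gamma>l), c)"
    using has_cutoff_cutoff_strategy by auto
  moreover have "z = ((m1, m2 + \<gamma>l * (?e - m1), \<gamma>l), c)" if "?P z" for z
  proof -
  obtain \<mu>1 \<mu>2 \<gamma> b where z: "z = ((\<mu>1, \<mu>2, \<gamma>), b)" by (metis surj_pair)
  with that obtain S where st: "steady_state \<sigma> m1 m2 0 \<gamma>l \<gamma>h q \<kappa> \<mu>1 \<mu>2 \<gamma> S" and b: "has_cutoff S b"
    by auto
  have opt: "optimal_strategy q \<kappa> (Psi \<sigma> \<mu>1 \<mu>2 \<gamma>) S" and "continues_with_pos_prob S"
    and \<mu>: "(\<mu>1, \<mu>2, \<gamma>) = pseudo_true \<sigma> m1 m2 0 \<gamma>l \<gamma>h S"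
    using st by (auto simp: steady_state_def)
  then have S: "S \<in> strategies" "continues_with_pos_prob S" by (auto simp: optimal_strategy_def)
  have eqs: "\<mu>1 = m1" "\<mu>2 = m2 + \<gamma>l * (cond_mean \<sigma> m1 {..<b} - m1)" "\<gamma> = \<gamma>l"
    using \<mu> pseudo[OF S b] by simp_all
  obtain t where t: "gain \<sigma> q t = \<kappa>" by (rule ex_gain_eq[OF assms(1,4,5)])
  \<comment> \<open>\<open>d\<close> is the indifference point under the given beliefs. Optimality
    makes it a cutoff of \<open>S\<close>, hence equal to \<open>b\<close>.\<close>
  define d where "d = (\<mu>2 + \<gamma> * \<mu>1 - t) / (1 + \<gamma>)"
  have "t = \<mu>2 + \<gamma> * \<mu>1 - (1 + \<gamma>) * d" using assms(2) eqs(3) by (simp add: d_def)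
  then have d: "gain \<sigma> q (\<mu>2 + \<gamma> * \<mu>1 - (1 + \<gamma>) * d) = \<kappa>" using t by simp
  then have "has_cutoff S d"
    using optimal_strategy_iff[OF assms(1,4,5) _ d, of S] opt assms(2) eqs(3) by simp
  then have "d = b" using b by (rule has_cutoff_unique)
  then have "gain \<sigma> q (m2 + (\<gamma>l * cond_mean \<sigma> m1 {..<b} - (1 + \<gamma>l) * b)) = \<kappa>"
    using d unfolding eqs by (simp add: algebra_simps)
  then have "gain \<sigma> q (m2 + (\<gamma>l * cond_mean \<sigma> m1 {..<b} - (1 + \<gamma>l) * b))
      = gain \<sigma> q (m2 + (\<gamma>l * ?e - (1 + \<gamma>l) * c))"
    by (simp only: c)
  then have "m2 + (\<gamma>l * cond_mean \<sigma> m1 {..<b} - (1 + \<gamma>l) * b) = m2 + (\<gamma>l * ?e - (1 + \<gamma>l) * c)"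
    by (rule gain_eqD[OF assms(1,4,5)])
  then have "b = c"
    using cutoff_equation_strict_antimono[OF assms(1,2), of b c m1]
      cutoff_equation_strict_antimono[OF assms(1,2), of c b m1]
    by (cases b c rule: linorder_cases) auto
  then show ?thesis by (simp add: z eqs)
  qed
  ultimately show ?thesis unfolding the_steady_state_def by (rule the_equality)
qed

theorem proposition4:
  fixes \<sigma> m1 m2 r \<gamma>l \<gamma>h :: real
  assumes "\<sigma> > 0"
    and "\<gamma>l \<le> \<gamma>h"
    and "r \<noteq> -1" and "\<gamma>l \<noteq> -1" and "\<gamma>h \<noteq> -1"
    and "r = 0"
    and "gamma_near r \<gamma>l \<gamma>h > 0"
  shows "(\<forall>\<kappa>. strict_mono_on {0..<1} (\<lambda>q. steady_belief2 \<sigma> m1 m2 r \<gamma>l \<gamma>h q \<kappa>)) \<and>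
    (\<forall>q\<in>{0..<1}. strict_antimono_on UNIV (\<lambda>\<kappa>. steady_belief2 \<sigma> m1 m2 r \<gamma>l \<gamma>h q \<kappa>)) \<and>
    (\<forall>q\<in>{0..<1}. \<forall>\<kappa>. steady_belief2 \<sigma> m1 m2 r \<gamma>l \<gamma>h q \<kappa> < m2) \<and>
    (\<forall>\<kappa>. strict_mono_on {0..<1} (\<lambda>q. steady_cutoff \<sigma> m1 m2 r \<gamma>l \<gamma>h q \<kappa>)) \<and>
    (\<forall>q\<in>{0..<1}. strict_antimono_on UNIV (\<lambda>\<kappa>. steady_cutoff \<sigma> m1 m2 r \<gamma>l \<gamma>h q \<kappa>))"
proof -
  have \<sigma>: "0 < \<sigma>" and r: "r = 0" using assms by auto
  have \<gamma>: "0 < \<gamma>l" using gamma_near_0_pos assms(2,6,7) by blast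
  \<comment> \<open>At a first draw equal to \<open>c\<close>, this is the excess of the perceived
    conditional mean of the second draw over \<open>c\<close>, under the beliefs that the cutoff
    \<open>c\<close> itself generates.\<close>
  define \<phi> where "\<phi> c = m2 + (\<gamma>l * cond_mean \<sigma> m1 {..<c} - (1 + \<gamma>l) * c)" for c
  define cut where "cut q \<kappa> = steady_cutoff \<sigma> m1 m2 r \<gamma>l \<gamma>h q \<kappa>" for q \<kappa>
  have \<phi>_less: "c < c'" if "\<phi> c' < \<phi> c" for c c'
    using that cutoff_equation_strict_antimono[OF \<sigma> \<gamma>, of c' c m1]
    by (cases c c' rule: linorder_cases) (auto simp: \<phi>_def)
  have steady: "gain \<sigma> q (\<phi> (cut q \<kappa>)) = \<kappa> \<and>
      steady_belief2 \<sigma> m1 m2 r \<gamma>l \<gamma>h q \<kappa> = m2 + \<gamma>l * (cond_mean \<sigma> m1 {..<cut q \<kappa>} - m1)"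
    if q: "0 \<le> q" "q < 1" for q \<kappa>
  proof -
    obtain t where t: "gain \<sigma> q t = \<kappa>" by (rule ex_gain_eq[OF \<sigma> q])
    obtain c where "\<gamma>l * cond_mean \<sigma> m1 {..<c} - (1 + \<gamma>l) * c = t - m2"
      by (rule ex_cutoff_equation[OF \<sigma> \<gamma>])
    then have c: "gain \<sigma> q (\<phi> c) = \<kappa>" using t by (simp add: \<phi>_def)
    then have "the_steady_state \<sigma> m1 m2 r \<gamma>l \<gamma>h q \<kappa>
        = ((m1, m2 + \<gamma>l * (cond_mean \<sigma> m1 {..<c} - m1), \<gamma>l), c)"
      unfolding r \<phi>_def by (rule the_steady_state_eq[OF \<sigma> \<gamma> assms(2) q])
    then show ?thesis using c by (simp add: cut_def steady_cutoff_def steady_belief2_def)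
  qed
  \<comment> \<open>\<open>q\<close> and \<open>\<kappa>\<close> affect the belief only through the
    cutoff, and the conditional mean increases with it.\<close>
  have belief_less: "steady_belief2 \<sigma> m1 m2 r \<gamma>l \<gamma>h q \<kappa> < steady_belief2 \<sigma> m1 m2 r \<gamma>l \<gamma>h q' \<kappa>'"
    if "0 \<le> q" "q < 1" "0 \<le> q'" "q' < 1" "cut q \<kappa> < cut q' \<kappa>'" for q \<kappa> q' \<kappa>'
    using steady[OF that(1,2)] steady[OF that(3,4)] strict_mono_cond_mean[OF \<sigma> that(5), of m1] \<gamma>
    by simp
  have cut_q: "cut q \<kappa> < cut q' \<kappa>" if q: "0 \<le> q" "q < q'" "q' < 1" for q q' \<kappa>
  proof -
    \<comment> \<open>At the cutoff for \<open>q'\<close> the smaller \<open>q\<close> yields a gain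
      below \<open>\<kappa>\<close>. Since \<open>\<phi>\<close> is decreasing, that cutoff lies
      beyond the one for \<open>q\<close>.\<close>
    have "gain \<sigma> q (\<phi> (cut q' \<kappa>)) < gain \<sigma> q' (\<phi> (cut q' \<kappa>))"
      by (rule gain_less_gain[OF \<sigma> q(2)])
    also have "\<dots> = gain \<sigma> q (\<phi> (cut q \<kappa>))" using steady q by simp
    finally show ?thesis using q gain_less_iff[OF \<sigma>, of q] \<phi>_less by simp
  qed
  have cut_\<kappa>: "cut q \<kappa>' < cut q \<kappa>" if q: "0 \<le> q" "q < 1" and "\<kappa> < \<kappa>'" for q \<kappa> \<kappa>'
  proof -
    have "gain \<sigma> q (\<phi> (cut q \<kappa>)) < gain \<sigma> q (\<phi> (cut q \<kappa>'))" using steady that by simp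
    then show ?thesis using gain_less_iff[OF \<sigma> q] \<phi>_less by simp
  qed
  \<comment> \<open>Selection drives the bias: the agent continues after low first draws, whose
    conditional mean is below \<open>m1\<close>, and \<open>\<gamma>l > 0\<close> turns this into
    pessimism about the second.\<close>
  have belief_m2: "steady_belief2 \<sigma> m1 m2 r \<gamma>l \<gamma>h q \<kappa> < m2" if "0 \<le> q" "q < 1" for q \<kappa>
    using steady[OF that] mult_pos_neg[OF \<gamma>, of "cond_mean \<sigma> m1 {..<cut q \<kappa>} - m1"]
      cond_mean_less_mean[OF \<sigma>, of m1 "cut q \<kappa>"] by simp
  show ?thesis
    unfolding cut_def[symmetric]
  proof (intro conjI allI ballI monotone_onI)
    fix q q' \<kappa> :: real
    assume "q \<in> {0..<1}" "q' \<in> {0..<1}" "q < q'"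
    then show "cut q \<kappa> < cut q' \<kappa>"
      and "steady_belief2 \<sigma> m1 m2 r \<gamma>l \<gamma>h q \<kappa> < steady_belief2 \<sigma> m1 m2 r \<gamma>l \<gamma>h q' \<kappa>"
      using cut_q[of q q' \<kappa>] belief_less[of q q' \<kappa> \<kappa>] by simp_all
  next
    fix q \<kappa> \<kappa>' :: real
    assume "q \<in> {0..<1}" "\<kappa> < \<kappa>'"
    then show "cut q \<kappa> > cut q \<kappa>'"
      and "steady_belief2 \<sigma> m1 m2 r \<gamma>l \<gamma>h q \<kappa> > steady_belief2 \<sigma> m1 m2 r \<gamma>l \<gamma>h q \<kappa>'"
      using cut_\<kappa>[of q \<kappa> \<kappa>'] belief_less[of q q \<kappa>' \<kappa>] by simp_all
  next
    fix q \<kappa> :: real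
    assume "q \<in> {0..<1}"
    then show "steady_belief2 \<sigma> m1 m2 r \<gamma>l \<gamma>h q \<kappa> < m2" using belief_m2 by simp
  qed
qed

end
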